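(* For all integers $n\geq 0$ and each $r\in\{22, 36, 50, 64, 78, 92\}$, we have \[ \mathcal{EO}_u(98n+r)\equiv 0 \pmod{64}. \]
   Context: For a positive integer $k$, let $f_k:=(q^k;q^k)_\infty=\prod_{i=1}^\infty(1-q^{ki})$. The integers $\mathcal{EO}_u(n)$, $n\ge 0$, are defined by $\sum_{n=0}^\infty \mathcal{EO}_u(n)q^n=\dfrac{f_4^2}{f_2^2}$. *)

theory Defs
  imports
    "HOL-Analysis.Infinite_Products"
    "HOL-Computational_Algebra.Formal_Power_Series"
    "HOL-Number_Theory.Cong"
begin

text \<open>
  The product is the library's infinite product with respect to the \<open>X\<close>-adic metric on formal
  power series. As \<open>i\<close> starts at \<open>0\<close>, the exponent is \<open>k (i + 1)\<close>. Only \<open>k > 0\<close> is meaningful.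
\<close>
definition eta_fps :: "nat \<Rightarrow> int fps" where
  "eta_fps k = (\<Prod>i. 1 - fps_X ^ (k * Suc i))"

lemma eta_fps_has_prod:
  assumes k: "k > 0"
  shows "(\<lambda>i. 1 - fps_X ^ (k * Suc i) :: int fps) has_prod eta_fps k"
proof -
  define P :: "nat \<Rightarrow> int fps" where "P = (\<lambda>n. \<Prod>i\<le>n. 1 - fps_X ^ (k * Suc i))"
  define L where "L = Abs_fps (\<lambda>n. fps_nth (P n) n)"
  have stable: "fps_nth (P m) n = fps_nth (P n) n" if "n \<le> m" for m n
    using that
  proof (induction m rule: dec_induct)
    case (step m)
    have "n < k * Suc (Suc m)"
      using step.hyps k by (cases k) auto
    moreover have "P (Suc m) = P m - fps_X ^ (k * Suc (Suc m)) * P m"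
      by (simp add: P_def algebra_simps)
    ultimately show ?case
      using step.IH by (simp only: fps_sub_nth fps_X_power_mult_nth) simp
  qed simp
  have "P \<longlonglongrightarrow> L"
    unfolding tendsto_fps_iff L_def
    by (auto simp: eventually_sequentially intro!: exI stable)
  moreover have "fps_nth L 0 = 1"
    using k by (simp add: L_def P_def)
  hence "L \<noteq> 0"
    by auto
  ultimately have "(\<lambda>i. 1 - fps_X ^ (k * Suc i)) has_prod L"
    by (simp add: has_prod_def raw_has_prod_def P_def)
  thus ?thesis
    unfolding eta_fps_def using has_prod_unique by blast
qed

lemma eta_fps_nth_0 [simp]:
  assumes k: "k > 0"
  shows "fps_nth (eta_fps k) 0 = 1"
proof -
  have prod0: "fps_nth (\<Prod>i\<le>n. 1 - fps_X ^ (k * Suc i) :: int fps) 0 = 1" for n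
    using k by (induction n) simp_all
  have "1 - fps_X ^ (k * Suc i) \<noteq> (0 :: int fps)" for i
  proof
    assume "1 - fps_X ^ (k * Suc i) = (0 :: int fps)"
    hence "fps_nth (1 - fps_X ^ (k * Suc i)) 0 = fps_nth (0 :: int fps) 0"
      by simp
    thus False
      using k by simp
  qed
  hence "(\<lambda>n. \<Prod>i\<le>n. 1 - fps_X ^ (k * Suc i)) \<longlonglongrightarrow> eta_fps k"
    using eta_fps_has_prod[OF k] by (auto simp: has_prod_def raw_has_prod_def)
  hence "\<forall>\<^sub>F n in sequentially. fps_nth (\<Prod>i\<le>n. 1 - fps_X ^ (k * Suc i)) 0 = fps_nth (eta_fps k) 0"
    unfolding tendsto_fps_iff by blast
  hence "\<forall>\<^sub>F n::nat in sequentially. fps_nth (eta_fps k) 0 = 1"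
    unfolding prod0 by (rule eventually_mono) (rule sym)
  thus ?thesis
    by simp
qed

text \<open>
  The type \<open>int\<close> has no field division, so the quotient \<open>f\<^sub>4\<^sup>2 / f\<^sub>2\<^sup>2\<close> is formed with the multiplicative
  inverse of \<open>f\<^sub>2\<^sup>2\<close> in the ring of power series; the second argument of \<^term>\<open>fps_right_inverse\<close> is
  the inverse of the constant term \<open>1\<close>.
\<close>
definition EO_u :: "nat \<Rightarrow> int" where
  "EO_u n = fps_nth ((eta_fps 4)\<^sup>2 * fps_right_inverse ((eta_fps 2)\<^sup>2) 1) n"

lemma EO_u_gen_fun: "Abs_fps EO_u * (eta_fps 2)\<^sup>2 = (eta_fps 4)\<^sup>2"
proof -
  have "(eta_fps 2)\<^sup>2 * fps_right_inverse ((eta_fps 2)\<^sup>2) 1 = 1"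
    by (rule fps_right_inverse) (simp add: fps_power_zeroth_eq_one)
  hence "(eta_fps 4)\<^sup>2 * ((eta_fps 2)\<^sup>2 * fps_right_inverse ((eta_fps 2)\<^sup>2) 1) = (eta_fps 4)\<^sup>2"
    by (simp only: mult_1_right)
  moreover have "Abs_fps EO_u = (eta_fps 4)\<^sup>2 * fps_right_inverse ((eta_fps 2)\<^sup>2) 1"
    by (rule fps_ext) (simp only: fps_nth_Abs_fps EO_u_def)
  ultimately show ?thesis
    by (simp only: mult_ac)
qed

end

theory Submission
  imports Defs
begin

text \<open>
  Write \<open>F = f\<^sub>4\<close>, \<open>A = \<Sum> q\<^bsup>2n\<^sup>2\<^esup>\<close>, \<open>B = \<Sum> (-1)\<^sup>n q\<^bsup>2n\<^sup>2\<^esup>\<close> and \<open>C = \<Sum> q\<^bsup>4n\<^sup>2\<^esup>\<close>. Gauss's identity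
  \<open>f\<^sub>2\<^sup>2 = F B\<close> turns the generating function into \<open>F / B\<close>, and modulo 64 the inverse of \<open>B\<close> is the
  polynomial \<open>2B + 8A + 24C - 32 - 2A\<^sup>2B + B\<^sup>3\<close>. So modulo 64 the generating function is a combination of
  \<open>f\<^sub>2\<^sup>2\<close>, \<open>F A\<close>, \<open>F C\<close>, \<open>F\<close>, \<open>f\<^sub>2\<^sup>2 A\<^sup>2\<close> and \<open>f\<^sub>2\<^sup>2 B\<^sup>2\<close>, all of them theta series.

  The coefficient of \<open>q\<^sup>M\<close> is needed when \<open>6M + 1 = 7n\<close> with \<open>n\<close> prime to 7. As \<open>-1\<close> is not a square
  modulo 7, those of \<open>F\<close>, \<open>f\<^sub>2\<^sup>2\<close> and \<open>F A\<close> vanish. In \<open>f\<^sub>2\<^sup>2 A\<^sup>2\<close> and \<open>f\<^sub>2\<^sup>2 B\<^sup>2\<close> one sums over pairs of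
  Gaussian integers \<open>(z, w)\<close> with \<open>|z|\<^sup>2 + 24|w|\<^sup>2 = 14n\<close>; modulo 7 these lie on the eight isotropic lines
  \<open>z = c w\<close>, \<open>|c|\<^sup>2 = 4\<close>, on which the units act with two orbits. The lines in the orbit of
  \<open>c = 3 + 3\<i>\<close> contribute 0 by a sign-reversing reflection. On the line \<open>c = 2\<close> the form divided by 7 splits
  into two copies of \<open>s\<^sup>2 + 6k\<^sup>2\<close> with \<open>s = -1\<close> modulo 6 and \<open>k\<close> odd. Let \<open>\<Psi>\<close> be the theta series of this
  form over \<open>k > 0\<close>, with sign \<open>(-1)\<^sup>i\<close> for \<open>s = 6i - 1\<close>; then the coefficient of \<open>f\<^sub>2\<^sup>2 A\<^sup>2\<close> is \<open>16 [\<Psi>\<^sup>2]\<^bsub>2n\<^esub>\<close> while that of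
  \<open>f\<^sub>2\<^sup>2 B\<^sup>2\<close> is 0. In the same way the coefficient of \<open>F C\<close> is \<open>-4 [\<Psi>]\<^bsub>n\<^esub>\<close>. What remains is
  \<open>-96 [\<Psi>]\<^bsub>n\<^esub> - 32 [\<Psi>\<^sup>2]\<^bsub>2n\<^esub>\<close>, which is divisible by 64 because \<open>[\<Psi>\<^sup>2]\<^bsub>2n\<^esub>\<close> and \<open>[\<Psi>]\<^bsub>n\<^esub>\<close> have the
  same parity.
\<close>

subsection \<open>The Jacobi triple product for formal power series\<close>

lemma fps_X_power_dvd_iff_nth:
  "fps_X ^ n dvd (f :: int fps) \<longleftrightarrow> (\<forall>i<n. fps_nth f i = 0)"
proof
  assume "fps_X ^ n dvd f"
  then show "\<forall>i<n. fps_nth f i = 0"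
    by (auto elim!: dvdE simp: fps_X_power_mult_nth)
next
  assume *: "\<forall>i<n. fps_nth f i = 0"
  have "f = fps_X ^ n * fps_shift n f"
    by (rule fps_ext) (use * in \<open>auto simp: fps_X_power_mult_nth\<close>)
  then show "fps_X ^ n dvd f"
    by (metis dvd_triv_left)
qed

text \<open>Identities of infinite products are proved through this criterion, with finite products
  modulo each power of X.\<close>

lemma fps_eqI_X_power_dvd:
  assumes "\<And>n. fps_X ^ Suc n dvd (f - g :: int fps)"
  shows "f = g"
  using assms by (auto simp: fps_eq_iff fps_X_power_dvd_iff_nth simp del: power_Suc)

section \<open>Gaussian binomials and the finite triple product\<close>

definition qpoch :: "'a :: comm_ring_1 \<Rightarrow> nat \<Rightarrow> 'a" where
  "qpoch q m = (\<Prod>i<m. 1 - q ^ Suc i)"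

text \<open>The Gaussian binomial coefficient, given by a Pascal rule, which makes sense without
  division in any commutative ring.\<close>

fun gbinom :: "'a :: comm_ring_1 \<Rightarrow> nat \<Rightarrow> nat \<Rightarrow> 'a" where
  "gbinom q m 0 = 1"
| "gbinom q 0 (Suc k) = 0"
| "gbinom q (Suc m) (Suc k) = gbinom q m (Suc k) + q ^ (m - k) * gbinom q m k"

lemma gbinom_eq_0: "m < k \<Longrightarrow> gbinom q m k = 0"
  by (induction q m k rule: gbinom.induct) auto

text \<open>The quotient formula cleared of denominators. The two Pascal terms combine by (1 -
  q^(d+1)) + q^(d+1) (1 - q^(k+1)) = 1 - q^(d+k+2).\<close>

lemma gbinom_qpoch:
  "k \<le> m \<Longrightarrow> gbinom q m k * qpoch q k * qpoch q (m - k) = qpoch q m"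
proof (induction q m k rule: gbinom.induct)
  case (3 q m k)
  show ?case
  proof (cases "k = m")
    case True
    then show ?thesis
      using 3 by (simp add: gbinom_eq_0 qpoch_def algebra_simps)
  next
    case False
    with 3 have k: "k < m" by simp
    then obtain d where d: "m = Suc (k + d)"
      by (auto dest: less_imp_Suc_add)
    have 1: "gbinom q m (Suc k) * qpoch q (Suc k) * qpoch q d = qpoch q m"
      and 2: "gbinom q m k * qpoch q k * qpoch q (Suc d) = qpoch q m"
      using 3 d by auto
    have s: "qpoch q (Suc i) = qpoch q i * (1 - q ^ Suc i)" for i
      by (simp add: qpoch_def)
    have "gbinom q (Suc m) (Suc k) * qpoch q (Suc k) * qpoch q (Suc m - Suc k)
      = (gbinom q m (Suc k) * qpoch q (Suc k) * qpoch q d) * (1 - q ^ Suc d)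
        + q ^ Suc d * (gbinom q m k * qpoch q k * qpoch q (Suc d)) * (1 - q ^ Suc k)"
      using d by (simp add: s algebra_simps del: power_Suc)
    also have "\<dots> = qpoch q m * (1 - q ^ (Suc d + Suc k))"
      unfolding 1 2 power_add by (simp add: algebra_simps del: power_Suc)
    also have "\<dots> = qpoch q (Suc m)"
      using d by (simp add: s add.commute)
    finally show ?thesis .
  qed
qed (auto simp: qpoch_def)

text \<open>The form homogeneous in x and y lets y later be a power of x, which takes the place of
  negative exponents.\<close>

lemma q_binomial_theorem:
  "(\<Prod>i<m. y + x * q ^ i) =
    (\<Sum>k\<le>m. q ^ (k choose 2) * gbinom q m k * x ^ k * y ^ (m - k))"
proof (induction m)
  case (Suc m)
  let ?t = "\<lambda>m k. q ^ (k choose 2) * gbinom q m k * x ^ k * y ^ (m - k)"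
  have e: "Suc k choose 2 = k + (k choose 2)" for k
    by (simp add: numeral_2_eq_2)
  have "(\<Sum>k\<le>Suc m. ?t (Suc m) k) = y ^ Suc m + (\<Sum>k\<le>m. ?t (Suc m) (Suc k))"
    by (subst sum.atMost_Suc_shift) (simp add: numeral_2_eq_2)
  also have "(\<Sum>k\<le>m. ?t (Suc m) (Suc k)) =
      (\<Sum>k\<le>m. q ^ (Suc k choose 2) * gbinom q m (Suc k) * x ^ Suc k * y ^ (m - k))
      + (\<Sum>k\<le>m. x * q ^ m * ?t m k)"
    unfolding sum.distrib [symmetric]
  proof (intro sum.cong refl)
    fix k assume "k \<in> {..m}"
    then have "q ^ m = q ^ k * q ^ (m - k)"
      by (simp add: power_add [symmetric])
    then show "?t (Suc m) (Suc k) = q ^ (Suc k choose 2) * gbinom q m (Suc k) * x ^ Suc k * y ^ (m - k)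
        + x * q ^ m * ?t m k"
      by (simp add: e power_add algebra_simps)
  qed
  also have "y ^ Suc m + ((\<Sum>k\<le>m. q ^ (Suc k choose 2) * gbinom q m (Suc k) * x ^ Suc k * y ^ (m - k))
      + (\<Sum>k\<le>m. x * q ^ m * ?t m k)) = (\<Sum>k\<le>Suc m. q ^ (k choose 2) * gbinom q m k * x ^ k * y ^ (Suc m - k))
      + (\<Sum>k\<le>m. x * q ^ m * ?t m k)"
    by (subst sum.atMost_Suc_shift[of "\<lambda>k. q ^ (k choose 2) * gbinom q m k * x ^ k * y ^ (Suc m - k)"])
      (simp add: numeral_2_eq_2)
  also have "(\<Sum>k\<le>Suc m. q ^ (k choose 2) * gbinom q m k * x ^ k * y ^ (Suc m - k)) = (\<Sum>k\<le>m. y * ?t m k)"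
    by (simp add: gbinom_eq_0 Suc_diff_le algebra_simps)
  also have "(\<Sum>k\<le>m. y * ?t m k) + (\<Sum>k\<le>m. x * q ^ m * ?t m k) = (\<Sum>k\<le>m. ?t m k) * (y + x * q ^ m)"
    by (simp add: sum_distrib_left sum_distrib_right sum.distrib algebra_simps)
  finally show ?case
    using Suc by simp
qed (simp add: numeral_2_eq_2)

text \<open>
  The exponents of the triple product with base \<open>x\<^sup>a\<close> and argument \<open>x\<^sup>b\<close>; they are nonnegative for \<open>0 < b < a\<close>,
  so the truncation \<^const>\<open>nat\<close> is harmless.
\<close>
definition jexp :: "nat \<Rightarrow> nat \<Rightarrow> int \<Rightarrow> nat" where
  "jexp a b k = nat (int a * (k * (k - 1) div 2) + int b * k)"

text \<open>The bound by |k| makes the fibres finite. For k = -m < 0 it comes from k (k - 1) / 2 >=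
  m and a - b >= 1.\<close>

lemma jexp_bounds:
  assumes "0 < b" "b < a"
  shows "int (jexp a b k) = int a * (k * (k - 1) div 2) + int b * k" and "nat \<bar>k\<bar> \<le> jexp a b k"
proof -
  have "\<bar>k\<bar> \<le> int a * (k * (k - 1) div 2) + int b * k"
  proof (cases "k \<ge> 0")
    case True
    then have "0 \<le> k * (k - 1)" by (cases "k = 0") auto
    then have "0 \<le> int a * (k * (k - 1) div 2)" by simp
    moreover have "k \<le> int b * k" using assms True mult_right_mono[of 1 "int b" k] by simp
    ultimately show ?thesis using True by simp
  next
    case False
    define m where "m = - k"
    have m: "m \<ge> 1" "k = - m" using False by (auto simp: m_def)
    have e: "k * (k - 1) = m * (m - 1) + m * 2" by (simp add: m algebra_simps)
    have "k * (k - 1) div 2 = m * (m - 1) div 2 + m" unfolding e by simp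
    moreover have "0 \<le> m * (m - 1) div 2" using m by simp
    ultimately have "m \<le> k * (k - 1) div 2" by simp
    then have "int a * m \<le> int a * (k * (k - 1) div 2)" by (simp add: mult_left_mono)
    moreover have "(int b + 1) * m \<le> int a * m" using assms m by (intro mult_right_mono) auto
    ultimately show ?thesis using m by (simp add: algebra_simps)
  qed
  then show "int (jexp a b k) = int a * (k * (k - 1) div 2) + int b * k" "nat \<bar>k\<bar> \<le> jexp a b k"
    by (auto simp: jexp_def)
qed

lemma choose_two_int: "2 * int (n choose 2) = int n * (int n - 1)"
  by (induction n) (auto simp: numeral_2_eq_2 algebra_simps)

text \<open>The q-binomial theorem for 2n factors with base x^a and y = x^(an), the summation index
  being shifted by n. The upper n factors give the exponents ai + b; the lower n, read backwards,
  give ai + (a - b).\<close>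

lemma finite_jacobi_triple_product:
  fixes x :: "'a :: idom"
  assumes ab: "0 < b" "b < a" and x: "x \<noteq> 0"
  shows "(\<Prod>i<n. (1 - x ^ (a * i + b)) * (1 - x ^ (a * i + (a - b)))) =
    (\<Sum>k\<in>{- int n..int n}. (- 1) ^ nat \<bar>k\<bar> * x ^ jexp a b k * gbinom (x ^ a) (2 * n) (nat (int n + k)))"
proof -
  \<comment> \<open>\<open>c\<close> is the exponent of the monomial split off from all 2n factors;
    it is cancelled at the end, which is where \<open>x \<noteq> 0\<close> enters.\<close>
  define c where "c = (\<Sum>i<n. a * i + b) + a * n * n"
  have c2: "2 * int c = int a * (3 * int n * int n - int n) + 2 * int b * int n"
  proof -
    have "2 * (\<Sum>i<n. int a * int i + int b) = int a * (int n * int n - int n) + 2 * int b * int n"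
      by (induction n) (auto simp: algebra_simps)
    then show ?thesis by (simp add: c_def algebra_simps)
  qed
  have "(\<Prod>i<2*n. x ^ (a * n) + (- (x ^ b)) * (x ^ a) ^ i) =
        (\<Prod>i<n. x ^ (a * n) + (- (x ^ b)) * (x ^ a) ^ i) * (\<Prod>i<n. x ^ (a * n) + (- (x ^ b)) * (x ^ a) ^ (n + i))"
    by (simp add: mult_2 prod.nat_group[symmetric] lessThan_atLeast0 prod.atLeastLessThan_concat[symmetric, of 0 n "n+n"] prod.shift_bounds_nat_ivl[of _ 0 n n, simplified] add.commute)
  also have "(\<Prod>i<n. x ^ (a * n) + (- (x ^ b)) * (x ^ a) ^ (n + i)) = x ^ (a * n * n) * (\<Prod>i<n. 1 - x ^ (a * i + b))"
  proof -
    have "x ^ (a * n) + (- (x ^ b)) * (x ^ a) ^ (n + i) = x ^ (a * n) * (1 - x ^ (a * i + b))" for i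
      by (simp add: power_add power_mult [symmetric] algebra_simps)
    then show ?thesis by (simp add: prod.distrib power_mult)
  qed
  also have "(\<Prod>i<n. x ^ (a * n) + (- (x ^ b)) * (x ^ a) ^ i) =
      (\<Prod>i<n. (- 1) * x ^ (a * i + b) * (1 - x ^ (a * (n - Suc i) + (a - b))))"
  proof (intro prod.cong refl)
    fix i assume "i \<in> {..<n}"
    then have "a * n = a * i + (a * (n - Suc i) + a)"
      by (auto simp: algebra_simps dest!: less_imp_Suc_add)
    then have "a * n = (a * i + b) + (a * (n - Suc i) + (a - b))"
      using ab by simp
    then have "x ^ (a * n) = x ^ (a * i + b) * x ^ (a * (n - Suc i) + (a - b))"
      by (simp only: power_add)
    then show "x ^ (a * n) + (- (x ^ b)) * (x ^ a) ^ i = (- 1) * x ^ (a * i + b) * (1 - x ^ (a * (n - Suc i) + (a - b)))"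
      by (simp add: power_add power_mult [symmetric] algebra_simps)
  qed
  also have "\<dots> = (- 1) ^ n * x ^ (\<Sum>i<n. a * i + b) * (\<Prod>i<n. 1 - x ^ (a * (n - Suc i) + (a - b)))"
    by (simp add: prod.distrib power_sum prod_uminus)
  also have "(\<Prod>i<n. 1 - x ^ (a * (n - Suc i) + (a - b))) = (\<Prod>i<n. 1 - x ^ (a * i + (a - b)))"
    by (rule prod.nat_diff_reindex)
  finally have L: "(\<Prod>i<2*n. x ^ (a * n) + (- (x ^ b)) * (x ^ a) ^ i) =
      (- 1) ^ n * x ^ c * (\<Prod>i<n. (1 - x ^ (a * i + b)) * (1 - x ^ (a * i + (a - b))))"
    by (simp only: c_def power_add prod.distrib mult_ac)
  have "(\<Prod>i<2*n. x ^ (a * n) + (- (x ^ b)) * (x ^ a) ^ i) =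
     (\<Sum>k\<le>2*n. (x ^ a) ^ (k choose 2) * gbinom (x ^ a) (2 * n) k * (- (x ^ b)) ^ k * (x ^ (a * n)) ^ (2 * n - k))"
    by (rule q_binomial_theorem)
  also have "\<dots> = (\<Sum>k\<in>{- int n..int n}. (- 1) ^ n * x ^ c * ((- 1) ^ nat \<bar>k\<bar> * x ^ jexp a b k * gbinom (x ^ a) (2 * n) (nat (int n + k))))"
  proof (rule sum.reindex_bij_witness[of _ "\<lambda>k. nat (int n + k)" "\<lambda>j. int j - int n"])
    fix j assume j: "j \<in> {..2*n}"
    define k where "k = int j - int n"
    have jn: "int j = int n + k" by (simp add: k_def)
    have "2 * (int a * int (j choose 2) + int b * int j + int a * int n * int (2 * n - j)) =
      2 * int c + int a * (k * (k - 1)) + 2 * int b * k"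
      using j unfolding c2
      by (simp add: distrib_left mult.left_commute[of 2] choose_two_int of_nat_diff jn algebra_simps)
    also have "k * (k - 1) = 2 * (k * (k - 1) div 2)"
      by simp
    finally have "2 * (int a * int (j choose 2) + int b * int j + int a * int n * int (2 * n - j)) =
        2 * (int c + (int a * (k * (k - 1) div 2) + int b * k))"
      by (simp only: algebra_simps)
    then have "int a * int (j choose 2) + int b * int j + int a * int n * int (2 * n - j) = int c + int (jexp a b k)"
      unfolding jexp_bounds(1)[OF ab] by (simp only: mult_cancel_left) simp
    then have "int (a * (j choose 2) + b * j + a * n * (2 * n - j)) = int (c + jexp a b k)"
      by simp
    then have E: "a * (j choose 2) + b * j + a * n * (2 * n - j) = c + jexp a b k"
      by (simp only: of_nat_eq_iff)
    have "even (int n + \<bar>k\<bar>) = even (int j)"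
      unfolding k_def by auto
    then have ev: "even (n + nat \<bar>k\<bar>) = even j"
      by (simp add: even_nat_iff)
    have "(- 1 :: 'a) ^ (n + nat \<bar>k\<bar>) = (- 1) ^ j"
      unfolding minus_one_power_iff ev ..
    then have sg: "(- 1 :: 'a) ^ j = (- 1) ^ n * (- 1) ^ nat \<bar>k\<bar>"
      by (simp only: power_add)
    have "(x ^ a) ^ (j choose 2) * gbinom (x ^ a) (2 * n) j * (- (x ^ b)) ^ j * (x ^ (a * n)) ^ (2 * n - j)
      = (- 1) ^ j * x ^ (a * (j choose 2) + b * j + a * n * (2 * n - j)) * gbinom (x ^ a) (2 * n) j"
      by (simp add: power_minus[of "x ^ b"] power_add power_mult [symmetric] mult_ac)
    also have "\<dots> = (- 1) ^ n * x ^ c * ((- 1) ^ nat \<bar>k\<bar> * x ^ jexp a b k * gbinom (x ^ a) (2 * n) j)"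
      unfolding E sg by (simp only: power_add mult_ac)
    finally show "(- 1) ^ n * x ^ c * ((- 1) ^ nat \<bar>int j - int n\<bar> * x ^ jexp a b (int j - int n) * gbinom (x ^ a) (2 * n) (nat (int n + (int j - int n))))
      = (x ^ a) ^ (j choose 2) * gbinom (x ^ a) (2 * n) j * (- (x ^ b)) ^ j * (x ^ (a * n)) ^ (2 * n - j)"
      unfolding k_def[symmetric] jn[symmetric] nat_int by (rule sym)
  qed auto
  finally show ?thesis
    using x unfolding L sum_distrib_left[symmetric] by simp
qed

section \<open>Truncation modulo powers of X and the infinite product identities\<close>

lemma qpoch_trunc: "j \<le> m \<Longrightarrow> q ^ Suc j dvd qpoch q m - qpoch q j"
proof (induction m rule: dec_induct)
  case (step m)
  have "q ^ Suc j dvd q ^ Suc m"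
    using step.hyps by (intro le_imp_power_dvd) simp
  then have "q ^ Suc j dvd (qpoch q m - qpoch q j) - qpoch q m * q ^ Suc m"
    by (rule dvd_diff[OF step.IH dvd_mult])
  also have "(qpoch q m - qpoch q j) - qpoch q m * q ^ Suc m = qpoch q (Suc m) - qpoch q j"
    by (simp add: qpoch_def algebra_simps)
  finally show ?case .
qed simp

lemma fps_X_power_dvd_cancel:
  fixes u f :: "int fps"
  assumes "fps_nth u 0 = 1" and "fps_X ^ m dvd u * f"
  shows "fps_X ^ m dvd f"
proof -
  have "u * fps_right_inverse u 1 = 1"
    by (rule fps_right_inverse) (simp add: assms(1))
  then have "f = fps_right_inverse u 1 * (u * f)"
    by (metis mult.assoc mult.commute mult_1)
  then show ?thesis
    using assms(2) by (metis dvd_mult)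
qed

text \<open>Modulo q^(r+1), where q = X^a, every \<open>qpoch\<close> of length at least r agrees
  with P = \<open>qpoch q r\<close>. So \<open>gbinom_qpoch\<close> reads G P^2 = P, and the unit
  P^2 can be cancelled from P^2 (G P - 1) = 0.\<close>

lemma gbinom_trunc:
  assumes a: "a > 0" and r: "r \<le> j" "r \<le> m - j" "r \<le> n" "j \<le> m"
  shows "fps_X ^ (a * Suc r) dvd gbinom (fps_X ^ a) m j * qpoch (fps_X ^ a) n - (1 :: int fps)"
proof -
  define q :: "int fps" where "q = fps_X ^ a"
  let ?P = "qpoch q"
  have D: "q ^ Suc r dvd ?P i - ?P r" if "r \<le> i" for i
    using that by (rule qpoch_trunc)
  have G: "gbinom q m j * ?P j * ?P (m - j) = ?P m"
    by (rule gbinom_qpoch) fact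
  have "(?P r * ?P r) * (gbinom q m j * ?P n - 1) =
     ?P n * (?P m - ?P r) + ?P r * (?P n - ?P r)
     - gbinom q m j * ?P n * (?P j * (?P (m - j) - ?P r) + ?P r * (?P j - ?P r))"
    unfolding G[symmetric] by (simp add: algebra_simps)
  moreover have "q ^ Suc r dvd \<dots>"
    using r by (intro dvd_diff dvd_add dvd_mult D) auto
  ultimately have "q ^ Suc r dvd (?P r * ?P r) * (gbinom q m j * ?P n - 1)"
    by simp
  moreover have "fps_nth (?P i) 0 = 1" for i
    using a by (induction i) (simp_all add: qpoch_def q_def power_mult[symmetric] del: power_Suc)
  then have "fps_nth (?P r * ?P r) 0 = 1"
    by simp
  ultimately show ?thesis
    unfolding q_def power_mult[symmetric] by (rule fps_X_power_dvd_cancel[rotated])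
qed

text \<open>The formal sum of w(i) q^e(i). It has this meaning when the fibres of \<open>e\<close>
  are finite, since a sum over an infinite set is 0 by default.\<close>

definition wgf :: "('i \<Rightarrow> int) \<Rightarrow> ('i \<Rightarrow> nat) \<Rightarrow> int fps" where
  "wgf w e = Abs_fps (\<lambda>n. \<Sum>i | e i = n. w i)"

lemma wgf_nth: "fps_nth (wgf w e) n = (\<Sum>i | e i = n. w i)"
  by (simp add: wgf_def)

lemma wgf_trunc:
  fixes e :: "int \<Rightarrow> nat"
  assumes "\<And>k. nat \<bar>k\<bar> \<le> e k"
  shows "fps_X ^ Suc n dvd wgf w e - (\<Sum>k\<in>{- int n..int n}. fps_const (w k) * fps_X ^ e k)"
  unfolding fps_X_power_dvd_iff_nth
proof (intro allI impI)
  fix i assume i: "i < Suc n"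
  have "fps_nth (\<Sum>k\<in>{- int n..int n}. fps_const (w k) * fps_X ^ e k) i =
      (\<Sum>k\<in>{- int n..int n}. if e k = i then w k else 0)"
    by (auto simp: fps_sum_nth intro!: sum.cong)
  also have "\<dots> = (\<Sum>k\<in>{k \<in> {- int n..int n}. e k = i}. w k)"
    by (rule sum.inter_filter [symmetric]) simp
  also have "{k \<in> {- int n..int n}. e k = i} = {k. e k = i}"
  proof -
    have "- int n \<le> k \<and> k \<le> int n" if "e k = i" for k
      using assms[of k] that i by linarith
    then show ?thesis by auto
  qed
  finally show "fps_nth (wgf w e - (\<Sum>k\<in>{- int n..int n}. fps_const (w k) * fps_X ^ e k)) i = 0"
    by (simp add: wgf_nth)
qed

definition jtheta :: "nat \<Rightarrow> nat \<Rightarrow> int fps" where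
  "jtheta a b = wgf (\<lambda>k. (- 1) ^ nat \<bar>k\<bar>) (jexp a b)"

text \<open>In the finite triple product the term of index k carries a \<open>gbinom\<close>, which
  times \<open>qpoch\<close> is 1 up to order n - |k|. The factor with exponent
  \<open>jexp a b k\<close>, at least |k|, supplies the rest.\<close>

lemma jacobi_triple_product_trunc:
  assumes ab: "0 < b" "b < a"
  shows "fps_X ^ Suc n dvd jtheta a b - qpoch (fps_X ^ a) n *
    (\<Prod>i<n. (1 - fps_X ^ (a * i + b)) * (1 - fps_X ^ (a * i + (a - b))))"
proof -
  let ?K = "{- int n..int n}" and ?q = "fps_X ^ a :: int fps"
  let ?T = "\<lambda>k. fps_const ((- 1) ^ nat \<bar>k\<bar>) * fps_X ^ jexp a b k :: int fps"
  have m1: "fps_const (- 1) = (- 1 :: int fps)"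
    by (rule fps_ext) simp
  have "fps_X ^ Suc n dvd ?T k * (gbinom ?q (2 * n) (nat (int n + k)) * qpoch ?q n - 1)" if "k \<in> ?K" for k
  proof -
    \<comment> \<open>\<open>r\<close> is the smaller of n + k and n - k, the two lengths that enter
      \<open>gbinom_trunc\<close>.\<close>
    define r where "r = n - nat \<bar>k\<bar>"
    have "fps_X ^ (a * Suc r) dvd gbinom ?q (2 * n) (nat (int n + k)) * qpoch ?q n - 1"
      using that ab unfolding r_def by (intro gbinom_trunc) auto
    then have "fps_X ^ jexp a b k * fps_X ^ (a * Suc r) dvd ?T k * (gbinom ?q (2 * n) (nat (int n + k)) * qpoch ?q n - 1)"
      by (intro mult_dvd_mono) auto
    moreover have "Suc n \<le> jexp a b k + a * Suc r"
    proof -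
      have "Suc r \<le> a * Suc r" using ab by (cases a) auto
      moreover have "Suc n \<le> jexp a b k + Suc r"
        using jexp_bounds(2)[OF ab, of k] that by (auto simp: r_def)
      ultimately show ?thesis by linarith
    qed
    then have "fps_X ^ Suc n dvd (fps_X ^ jexp a b k * fps_X ^ (a * Suc r) :: int fps)"
      unfolding power_add[symmetric] by (rule le_imp_power_dvd)
    ultimately show ?thesis
      by (rule dvd_trans[rotated])
  qed
  then have "fps_X ^ Suc n dvd (\<Sum>k\<in>?K. ?T k * (gbinom ?q (2 * n) (nat (int n + k)) * qpoch ?q n - 1))"
    by (rule dvd_sum)
  moreover have "fps_X ^ Suc n dvd jtheta a b - (\<Sum>k\<in>?K. ?T k)"
    unfolding jtheta_def by (intro wgf_trunc jexp_bounds ab)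
  ultimately have "fps_X ^ Suc n dvd (jtheta a b - (\<Sum>k\<in>?K. ?T k))
      - (\<Sum>k\<in>?K. ?T k * (gbinom ?q (2 * n) (nat (int n + k)) * qpoch ?q n - 1))"
    by (rule dvd_diff[rotated])
  also have "\<dots> = jtheta a b - qpoch ?q n * (\<Sum>k\<in>?K. ?T k * gbinom ?q (2 * n) (nat (int n + k)))"
    by (simp add: sum_distrib_left sum_subtractf algebra_simps)
  also have "(\<Sum>k\<in>?K. ?T k * gbinom ?q (2 * n) (nat (int n + k))) =
    (\<Prod>i<n. (1 - fps_X ^ (a * i + b)) * (1 - fps_X ^ (a * i + (a - b))))"
    by (subst finite_jacobi_triple_product[OF ab])
       (simp_all add: fps_const_power[symmetric] m1 del: fps_const_power)
  finally show ?thesis .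
qed

lemma eta_fps_trunc:
  assumes k: "k > 0" and m: "n \<le> m"
  shows "fps_X ^ Suc n dvd eta_fps k - qpoch (fps_X ^ k) m"
proof -
  let ?P = "\<lambda>n. \<Prod>i\<le>n. 1 - fps_X ^ (k * Suc i) :: int fps"
  have P: "?P i = qpoch (fps_X ^ k) (Suc i)" for i
    by (simp only: qpoch_def lessThan_Suc_atMost power_mult)
  have "1 - fps_X ^ (k * Suc i) \<noteq> (0 :: int fps)" for i
  proof
    assume "1 - fps_X ^ (k * Suc i) = (0 :: int fps)"
    then have "fps_nth (1 - fps_X ^ (k * Suc i)) 0 = fps_nth (0 :: int fps) 0"
      by simp
    then show False
      using k by simp
  qed
  then have "?P \<longlonglongrightarrow> eta_fps k"
    using eta_fps_has_prod[OF k] by (auto simp: has_prod_def raw_has_prod_def)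
  then have lim: "\<forall>\<^sub>F l in sequentially. fps_nth (?P l) i = fps_nth (eta_fps k) i" for i
    unfolding tendsto_fps_iff by blast
  show ?thesis
    unfolding fps_X_power_dvd_iff_nth
  proof (intro allI impI)
    fix i assume i: "i < Suc n"
    have "\<forall>\<^sub>F l in sequentially. fps_nth (?P l) i = fps_nth (eta_fps k) i \<and> l \<ge> m"
      using lim eventually_ge_at_top by (rule eventually_conj)
    then obtain l where l: "fps_nth (?P l) i = fps_nth (eta_fps k) i" "m \<le> l"
      using eventually_happens'[OF sequentially_bot] by blast
    have "i < k * Suc m"
      using i m k by (cases k) auto
    moreover have "(fps_X ^ k) ^ Suc m dvd ?P l - qpoch (fps_X ^ k) m"
      unfolding P using l by (intro qpoch_trunc) simp
    ultimately have "fps_nth (?P l) i = fps_nth (qpoch (fps_X ^ k) m) i"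
      by (auto simp: power_mult[symmetric] fps_X_power_dvd_iff_nth simp del: power_Suc)
    then show "fps_nth (eta_fps k - qpoch (fps_X ^ k) m) i = 0"
      using l by simp
  qed
qed

text \<open>The triple product with a = 3k and b = k: the residues k, 2k and 0 modulo 3k together
  give all multiples of k.\<close>

theorem euler_pentagonal:
  assumes k: "k > 0"
  shows "eta_fps k = jtheta (3 * k) k"
proof (rule fps_eqI_X_power_dvd)
  fix n
  have P: "qpoch (fps_X ^ k) (3 * n) = qpoch (fps_X ^ (3 * k)) n *
      (\<Prod>i<n. (1 - fps_X ^ (3 * k * i + k)) * (1 - fps_X ^ (3 * k * i + (3 * k - k)) :: int fps))"
  proof (induction n)
    case (Suc n)
    have s: "qpoch q (Suc i) = qpoch q i * (1 - q ^ Suc i)" for q :: "int fps" and i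
      by (simp add: qpoch_def)
    have "3 * Suc n = Suc (Suc (Suc (3 * n)))" by simp
    then have "qpoch (fps_X ^ k :: int fps) (3 * Suc n) = qpoch (fps_X ^ k) (3 * n) *
      ((1 - fps_X ^ (3 * k * n + k)) * (1 - fps_X ^ (3 * k * n + (3 * k - k))) * (1 - (fps_X ^ (3 * k)) ^ Suc n))"
      by (simp only: s power_mult[symmetric] mult.assoc) (simp add: algebra_simps del: power_Suc)
    then show ?case
      unfolding Suc.IH by (simp add: s mult_ac del: power_Suc)
  qed (simp add: qpoch_def)
  have "fps_X ^ Suc n dvd (eta_fps k - qpoch (fps_X ^ k) (3 * n)) -
    (jtheta (3 * k) k - qpoch (fps_X ^ (3 * k)) n *
      (\<Prod>i<n. (1 - fps_X ^ (3 * k * i + k)) * (1 - fps_X ^ (3 * k * i + (3 * k - k)))))"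
    using k by (intro dvd_diff eta_fps_trunc jacobi_triple_product_trunc) auto
  then show "fps_X ^ Suc n dvd eta_fps k - jtheta (3 * k) k"
    unfolding P by simp
qed

text \<open>Separating odd and even multiples of k gives f_k = O f_2k. In the triple product with a
  = 2k, b = k the two linear families coincide, so that it equals f_2k O^2.\<close>

theorem gauss_theta:
  assumes k: "k > 0"
  shows "(eta_fps k)\<^sup>2 = eta_fps (2 * k) * jtheta (2 * k) k"
proof (rule fps_eqI_X_power_dvd)
  fix n
  let ?O = "\<Prod>i<n. 1 - fps_X ^ (2 * k * i + k) :: int fps" and ?Q = "qpoch (fps_X ^ (2 * k)) n :: int fps"
  let ?E = "qpoch (fps_X ^ k) (2 * n) :: int fps"
  have P: "?E = ?O * ?Q"
  proof (induction n)
    case (Suc n)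
    have s: "qpoch q (Suc i) = qpoch q i * (1 - q ^ Suc i)" for q :: "int fps" and i
      by (simp add: qpoch_def)
    have "2 * Suc n = Suc (Suc (2 * n))" by simp
    then have "qpoch (fps_X ^ k :: int fps) (2 * Suc n) = qpoch (fps_X ^ k) (2 * n) *
      ((1 - fps_X ^ (2 * k * n + k)) * (1 - (fps_X ^ (2 * k)) ^ Suc n))"
      by (simp only: s power_mult[symmetric] mult.assoc) (simp add: algebra_simps del: power_Suc)
    then show ?case
      unfolding Suc.IH by (simp add: s mult_ac del: power_Suc)
  qed (simp add: qpoch_def)
  have J: "fps_X ^ Suc n dvd jtheta (2 * k) k - ?Q * (?O * ?O)"
    using jacobi_triple_product_trunc[of k "2 * k" n] k by (simp add: prod.distrib mult_2)
  have e: "(eta_fps k)\<^sup>2 - eta_fps (2 * k) * jtheta (2 * k) k =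
     (eta_fps k + ?E) * (eta_fps k - ?E) - (eta_fps (2 * k) - ?Q) * jtheta (2 * k) k
     - ?Q * (jtheta (2 * k) k - ?Q * (?O * ?O))"
    unfolding P by (simp add: algebra_simps power2_eq_square)
  show "fps_X ^ Suc n dvd (eta_fps k)\<^sup>2 - eta_fps (2 * k) * jtheta (2 * k) k"
    unfolding e using k by (intro dvd_diff dvd_mult dvd_mult2 eta_fps_trunc J) auto
qed

subsection \<open>Theta series modulo 64\<close>

definition fin_fibres :: "('i \<Rightarrow> nat) \<Rightarrow> bool" where
  "fin_fibres e \<longleftrightarrow> (\<forall>n. finite {i. e i = n})"

lemma fin_fibresD: "fin_fibres e \<Longrightarrow> finite {i. e i = n}"
  by (simp add: fin_fibres_def)

lemma fin_fibres_comp: "fin_fibres e \<Longrightarrow> inj f \<Longrightarrow> fin_fibres (\<lambda>i. e (f i))"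
  using finite_vimageI[of "{i. e i = n}" f for n] by (fastforce simp: fin_fibres_def vimage_def)

lemma fin_fibres_int: "(\<And>k. nat \<bar>k\<bar> \<le> e k) \<Longrightarrow> fin_fibres (e :: int \<Rightarrow> nat)"
  unfolding fin_fibres_def
proof
  fix n assume *: "\<And>k. nat \<bar>k\<bar> \<le> e k"
  have "k \<in> {- int n..int n}" if "e k = n" for k
    using *[of k] that by auto
  then have "{k. e k = n} \<subseteq> {- int n..int n}"
    by blast
  then show "finite {k. e k = n}"
    by (rule finite_subset) simp
qed

lemma fin_fibres_nat: "(\<And>k. k \<le> e k) \<Longrightarrow> fin_fibres (e :: nat \<Rightarrow> nat)"
  unfolding fin_fibres_def
proof
  fix n assume *: "\<And>k. k \<le> e k"
  have "{k. e k = n} \<subseteq> {..n}"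
    using * by auto
  then show "finite {k. e k = n}"
    by (rule finite_subset) simp
qed

lemma fibre_pair:
  "{p. (case p of (i, j) \<Rightarrow> e1 i + e2 j) = n} = (SIGMA i:(\<Union>k\<le>n. {i. e1 i = k}). {j. e2 j = n - e1 i})"
  for n :: nat
  by auto

lemma fin_fibres_pair:
  assumes "fin_fibres e1" "fin_fibres e2"
  shows "fin_fibres (\<lambda>(i, j). e1 i + e2 j)"
  unfolding fin_fibres_def fibre_pair
  by (intro allI finite_SigmaI finite_UN_I) (auto intro: fin_fibresD assms)

lemma wgf_mult:
  assumes "fin_fibres e1" "fin_fibres e2"
  shows "wgf w1 e1 * wgf w2 e2 = wgf (\<lambda>(i, j). w1 i * w2 j) (\<lambda>(i, j). e1 i + e2 j)"
proof (rule fps_ext)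
  fix n
  have "fps_nth (wgf w1 e1 * wgf w2 e2) n =
      (\<Sum>k\<le>n. \<Sum>i | e1 i = k. \<Sum>j | e2 j = n - e1 i. w1 i * w2 j)"
    by (auto simp: fps_mult_nth wgf_nth sum_product atLeast0AtMost intro!: sum.cong)
  also have "\<dots> = (\<Sum>i\<in>(\<Union>k\<le>n. {i. e1 i = k}). \<Sum>j | e2 j = n - e1 i. w1 i * w2 j)"
    by (rule sum.UNION_disjoint[symmetric]) (auto intro: fin_fibresD assms)
  also have "\<dots> = (\<Sum>(i, j)\<in>{p. (case p of (i, j) \<Rightarrow> e1 i + e2 j) = n}. w1 i * w2 j)"
    unfolding fibre_pair by (rule sum.Sigma) (auto intro: fin_fibresD assms)
  finally show "fps_nth (wgf w1 e1 * wgf w2 e2) n = fps_nth (wgf (\<lambda>(i, j). w1 i * w2 j) (\<lambda>(i, j). e1 i + e2 j)) n"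
    by (simp add: wgf_nth)
qed

lemma wgf_split:
  assumes "fin_fibres e" "inj f" "inj g" "range f \<inter> range g = {}" "range f \<union> range g = UNIV"
  shows "wgf w e = wgf (\<lambda>i. w (f i)) (\<lambda>i. e (f i)) + wgf (\<lambda>i. w (g i)) (\<lambda>i. e (g i))"
proof (rule fps_ext)
  fix n
  have 1: "{i. e i = n} = f ` {i. e (f i) = n} \<union> g ` {i. e (g i) = n}"
    using assms(5) by auto
  have 2: "finite {i. e (f i) = n}" "finite {i. e (g i) = n}"
    using fin_fibres_comp[OF assms(1)] assms(2,3) by (auto simp: fin_fibres_def)
  show "fps_nth (wgf w e) n = fps_nth (wgf (\<lambda>i. w (f i)) (\<lambda>i. e (f i)) + wgf (\<lambda>i. w (g i)) (\<lambda>i. e (g i))) n"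
    unfolding fps_add_nth wgf_nth 1 using 2 assms(2-4)
    by (subst sum.union_disjoint) (auto simp: sum.reindex inj_on_subset)
qed

lemma wgf_int_split:
  assumes "fin_fibres (e :: int \<Rightarrow> nat)"
  shows "wgf w e = wgf (\<lambda>n::nat. w (int n)) (\<lambda>n. e (int n))
    + wgf (\<lambda>n::nat. w (- 1 - int n)) (\<lambda>n. e (- 1 - int n))"
proof (rule wgf_split[OF assms])
  have "k \<in> range int \<union> range (\<lambda>n. - 1 - int n)" for k :: int
  proof (cases "k \<ge> 0")
    case True
    then have "k = int (nat k)" by simp
    then show ?thesis by blast
  next
    case False
    then have "k = - 1 - int (nat (- 1 - k))" by simp
    then show ?thesis by blast
  qed
  then show "range int \<union> range (\<lambda>n. - 1 - int n) = UNIV" by auto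
qed (auto simp: inj_def)

lemma wgf_nat_split:
  assumes "fin_fibres (e :: nat \<Rightarrow> nat)"
  shows "wgf w e = wgf (\<lambda>n. w (2 * n)) (\<lambda>n. e (2 * n)) + wgf (\<lambda>n. w (2 * n + 1)) (\<lambda>n. e (2 * n + 1))"
proof (rule wgf_split[OF assms])
  show "range (\<lambda>n::nat. 2 * n) \<inter> range (\<lambda>n. 2 * n + 1) = {}"
    by (auto simp: image_iff) presburger
  have "n \<in> range (\<lambda>n::nat. 2 * n) \<union> range (\<lambda>n. 2 * n + 1)" for n
    by (cases "even n") (auto elim!: evenE oddE)
  then show "range (\<lambda>n::nat. 2 * n) \<union> range (\<lambda>n. 2 * n + 1) = UNIV" by auto
qed (auto simp: inj_def)

text \<open>Squaring modulo 2, with the error kept. Off the diagonal (i, j) and (j, i) contribute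
  equally; \<open>to_nat\<close> supplies a linear order that selects one of them.\<close>

lemma wgf_square:
  fixes e :: "'i :: countable \<Rightarrow> nat"
  assumes e: "fin_fibres e"
  shows "\<exists>P. (wgf w e)\<^sup>2 = wgf (\<lambda>i. (w i)\<^sup>2) (\<lambda>i. 2 * e i) + 2 * P"
proof -
  let ?R = "\<lambda>n. {(i, j). e i + e j = n \<and> to_nat i < to_nat j}"
  define P where "P = Abs_fps (\<lambda>n. \<Sum>(i, j)\<in>?R n. w i * w j)"
  have fin: "finite {p. (case p of (i, j) \<Rightarrow> e i + e j) = n}" for n
    using fin_fibres_pair[OF e e] by (auto simp: fin_fibres_def)
  have "fps_nth ((wgf w e)\<^sup>2) n = fps_nth (wgf (\<lambda>i. (w i)\<^sup>2) (\<lambda>i. 2 * e i) + 2 * P) n" for n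
  proof -
    let ?D = "(\<lambda>i. (i, i)) ` {i. 2 * e i = n}" and ?R' = "prod.swap ` ?R n"
    have "{p. (case p of (i, j) \<Rightarrow> e i + e j) = n} = ?D \<union> (?R n \<union> ?R')"
      by (auto simp: image_iff)
    moreover have "finite (?R n)" "finite ?D"
      by (rule finite_subset[OF _ fin[of n]]; force)+
    moreover have "?D \<inter> (?R n \<union> ?R') = {}" "?R n \<inter> ?R' = {}"
      by auto
    ultimately have "fps_nth ((wgf w e)\<^sup>2) n = (\<Sum>(i, j)\<in>?D. w i * w j) + ((\<Sum>(i, j)\<in>?R n. w i * w j) + (\<Sum>(i, j)\<in>?R'. w i * w j))"
      by (simp add: power2_eq_square wgf_mult[OF e e] wgf_nth sum.union_disjoint)
    moreover have "(\<Sum>(i, j)\<in>?D. w i * w j) = fps_nth (wgf (\<lambda>i. (w i)\<^sup>2) (\<lambda>i. 2 * e i)) n"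
      by (subst sum.reindex) (auto simp: inj_on_def wgf_nth power2_eq_square)
    moreover have "(\<Sum>(i, j)\<in>?R'. w i * w j) = fps_nth P n"
      by (subst sum.reindex) (auto simp: P_def mult.commute intro!: sum.cong)
    ultimately show ?thesis
      by (simp add: P_def numeral_fps_const)
  qed
  then show ?thesis
    by (auto simp: fps_eq_iff)
qed

section \<open>Pentagonal and square theta series\<close>

definition sg :: "int \<Rightarrow> int" where
  "sg k = (if even k then 1 else - 1)"

lemma sg_eq_power: "(- 1) ^ nat \<bar>k\<bar> = sg k"
  by (simp add: sg_def minus_one_power_iff even_nat_iff)

lemma sg_simps [simp]: "sg (- k) = sg k" "sg 0 = 1" "sg 1 = - 1" "sg k * sg k = 1"
  by (auto simp: sg_def)

lemma sg_add: "sg (j + k) = sg j * sg k"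
  by (auto simp: sg_def)

text \<open>
  Since \<open>12 k (3k - 1) + 1 = (6k - 1)\<^sup>2\<close>, the pentagonal series is a theta series in \<open>6k - 1\<close>.
\<close>
definition pent :: "nat \<Rightarrow> int fps" where
  "pent c = wgf sg (\<lambda>k. c * nat (k * (3 * k - 1)))"

definition theta :: "nat \<Rightarrow> int fps" where
  "theta c = wgf (\<lambda>_. 1) (\<lambda>k::int. c * nat \<bar>k\<bar> ^ 2)"

definition theta_alt :: "nat \<Rightarrow> int fps" where
  "theta_alt c = wgf sg (\<lambda>k. c * nat \<bar>k\<bar> ^ 2)"

lemma pent_exp_nonneg: "0 \<le> k * (3 * k - 1)" for k :: int
  by (cases "k \<ge> 1") (auto simp: zero_le_mult_iff)

lemma fin_fibres_pent: "c > 0 \<Longrightarrow> fin_fibres (\<lambda>k::int. c * nat (k * (3 * k - 1)))"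
proof (rule fin_fibres_int)
  fix k :: int assume c: "c > 0"
  have "\<bar>k\<bar> \<le> k * (3 * k - 1)"
  proof (cases "k \<ge> 1")
    case True
    then have "k * 1 \<le> k * (3 * k - 1)" by (intro mult_left_mono) auto
    then show ?thesis using True by simp
  next
    case False
    then have "(- k) * 1 \<le> (- k) * (1 - 3 * k)" by (intro mult_left_mono) auto
    then show ?thesis using False by (simp add: algebra_simps)
  qed
  then have "nat \<bar>k\<bar> \<le> 1 * nat (k * (3 * k - 1))" by simp
  also have "\<dots> \<le> c * nat (k * (3 * k - 1))" using c by (intro mult_right_mono) auto
  finally show "nat \<bar>k\<bar> \<le> c * nat (k * (3 * k - 1))" .
qed

lemma le_mult_square: "c > 0 \<Longrightarrow> k \<le> c * k ^ 2" for c k :: nat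
proof (cases "k = 0")
  case False
  assume "c > 0"
  then have "1 * (k * 1) \<le> c * (k * k)"
    using False by (intro mult_mono) auto
  then show ?thesis by (simp add: power2_eq_square)
qed simp

lemma fin_fibres_square: "c > 0 \<Longrightarrow> fin_fibres (\<lambda>k::int. c * nat \<bar>k\<bar> ^ 2)"
  by (intro fin_fibres_int le_mult_square)

lemma eta_fps_eq_pent: "c > 0 \<Longrightarrow> eta_fps (2 * c) = pent c"
proof -
  assume c: "c > 0"
  have "jexp (3 * (2 * c)) (2 * c) k = c * nat (k * (3 * k - 1))" for k
  proof -
    have "2 * (k * (k - 1) div 2) = k * (k - 1)" by simp
    moreover have "int (3 * (2 * c)) * (k * (k - 1) div 2) = int (3 * c) * (2 * (k * (k - 1) div 2))"
      by simp
    ultimately have "int (3 * (2 * c)) * (k * (k - 1) div 2) + int (2 * c) * k = int c * (k * (3 * k - 1))"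
      by (simp add: algebra_simps)
    then show ?thesis
      using pent_exp_nonneg[of k] by (simp add: jexp_def nat_mult_distrib)
  qed
  then have "jexp (3 * (2 * c)) (2 * c) = (\<lambda>k. c * nat (k * (3 * k - 1)))" ..
  then show ?thesis
    using c by (simp add: euler_pentagonal jtheta_def pent_def sg_eq_power)
qed

lemma jtheta_eq_theta_alt: "c > 0 \<Longrightarrow> jtheta (2 * c) c = theta_alt c"
proof -
  assume c: "c > 0"
  have "jexp (2 * c) c k = c * nat \<bar>k\<bar> ^ 2" for k
  proof -
    have "2 * (k * (k - 1) div 2) = k * (k - 1)" by simp
    moreover have "int (2 * c) * (k * (k - 1) div 2) = int c * (2 * (k * (k - 1) div 2))"
      by simp
    ultimately have "int (2 * c) * (k * (k - 1) div 2) + int c * k = int c * k\<^sup>2"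
      by (simp add: algebra_simps power2_eq_square)
    also have "\<dots> = int (c * nat \<bar>k\<bar> ^ 2)" by simp
    finally show ?thesis
      by (simp only: jexp_def nat_int)
  qed
  then have "jexp (2 * c) c = (\<lambda>k. c * nat \<bar>k\<bar> ^ 2)" ..
  then show ?thesis
    by (simp add: jtheta_def theta_alt_def sg_eq_power)
qed

section \<open>Relations between theta series and an inverse modulo 64\<close>

lemma fin_fibres_odd_square: "c > 0 \<Longrightarrow> fin_fibres (\<lambda>n::nat. c * (2 * n + 1)\<^sup>2)"
  by (rule fin_fibres_nat, rule order_trans[OF _ le_mult_square]) auto

lemma fin_fibres_Suc_square: "c > 0 \<Longrightarrow> fin_fibres (\<lambda>n::nat. c * (Suc n)\<^sup>2)"
  by (rule fin_fibres_nat, rule order_trans[OF _ le_mult_square]) auto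

lemma wgf_nat_0_split:
  assumes "fin_fibres (e :: nat \<Rightarrow> nat)" "e 0 = 0" "w 0 = 1"
  shows "wgf w e = 1 + wgf (\<lambda>n. w (Suc n)) (\<lambda>n. e (Suc n))"
proof -
  have "wgf w e = wgf (\<lambda>_::unit. w 0) (\<lambda>_. e 0) + wgf (\<lambda>n. w (Suc n)) (\<lambda>n. e (Suc n))"
    by (rule wgf_split[OF assms(1)]) (auto simp: inj_def image_iff dest: not0_implies_Suc)
  moreover have "wgf (\<lambda>_::unit. w 0) (\<lambda>_. e 0) = 1"
    by (rule fps_ext) (simp add: assms wgf_nth)
  ultimately show ?thesis by simp
qed

lemma wgf_even_square:
  assumes c: "c > 0" and w: "w 0 = 1" "\<And>k. w (- k) = w k"
  shows "wgf w (\<lambda>k::int. c * nat \<bar>k\<bar> ^ 2) = 1 + 2 * wgf (\<lambda>n. w (int (Suc n))) (\<lambda>n. c * (Suc n)\<^sup>2)"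
proof -
  have n: "c * nat \<bar>- 1 - int n\<bar> ^ 2 = c * (Suc n)\<^sup>2" "w (- 1 - int n) = w (int (Suc n))" for n
    using w(2)[of "int (Suc n)"] by (simp_all add: nat_add_distrib)
  have "fin_fibres (\<lambda>n::nat. c * n\<^sup>2)"
    using c by (intro fin_fibres_nat le_mult_square)
  from wgf_nat_0_split[OF this, of "\<lambda>n. w (int n)"] show ?thesis
    unfolding wgf_int_split[OF fin_fibres_square[OF c]] n using w by simp
qed

text \<open>The classical phi(q)^2 + phi(-q)^2 = 2 phi(q^2)^2, with q^c for q. Adding the squares
  keeps the pairs with x + y even, which are the (u + v, u - v).\<close>

lemma theta_squares: "(theta c)\<^sup>2 + (theta_alt c)\<^sup>2 = 2 * (theta (2 * c))\<^sup>2" if c: "c > 0"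
proof (rule fps_ext)
  fix n
  let ?e = "\<lambda>c (x, y). c * nat \<bar>x\<bar> ^ 2 + c * nat \<bar>y\<bar> ^ 2"
  note f = fin_fibres_square
  have fin: "finite {p. ?e c p = n}"
    using fin_fibres_pair[OF f f, of c c] c by (auto simp: fin_fibres_def)
  have c2: "2 * c > 0" using c by simp
  have "fps_nth ((theta c)\<^sup>2 + (theta_alt c)\<^sup>2) n = (\<Sum>p | ?e c p = n. 1 + (case p of (x, y) \<Rightarrow> sg x * sg y))"
    using c by (simp add: theta_def theta_alt_def power2_eq_square[of "wgf _ _"] wgf_mult[OF f f] wgf_nth sum.distrib case_prod_unfold)
  also have "\<dots> = (\<Sum>p | ?e c p = n. if even (fst p + snd p) then 2 else 0)"
    by (intro sum.cong) (auto simp: sg_def)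
  also have "\<dots> = (\<Sum>p\<in>{p \<in> {p. ?e c p = n}. even (fst p + snd p)}. 2)"
    by (rule sum.inter_filter[OF fin, symmetric])
  also have "\<dots> = (\<Sum>p | ?e (2 * c) p = n. 2)"
  proof (rule sum.reindex_bij_witness[of _ "\<lambda>(u, v). (u + v, u - v)" "\<lambda>(x, y). ((x + y) div 2, (x - y) div 2)"])
    have E: "?e (2 * c) (u, v) = ?e c (u + v, u - v)" for u v
    proof -
      have "int (?e (2 * c) (u, v)) = int (?e c (u + v, u - v))"
        by (simp add: power2_eq_square algebra_simps)
      then show ?thesis by (simp only: of_nat_eq_iff)
    qed
    show "(case q of (u, v) \<Rightarrow> (u + v, u - v)) \<in> {p \<in> {p. ?e c p = n}. even (fst p + snd p)}"
      if "q \<in> {p. ?e (2 * c) p = n}" for q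
      using that E by (cases q) auto
    fix p :: "int \<times> int" assume p: "p \<in> {p \<in> {p. ?e c p = n}. even (fst p + snd p)}"
    obtain x y where xy: "p = (x, y)" by (cases p)
    then have "even (x + y)" using p by simp
    then obtain u where u: "x + y = 2 * u" by (elim evenE)
    define v where "v = x - u"
    have "x = u + v" "y = u - v" using u by (auto simp: v_def)
    then show "(case case p of (x, y) \<Rightarrow> ((x + y) div 2, (x - y) div 2) of (u, v) \<Rightarrow> (u + v, u - v)) = p"
      and "(case p of (x, y) \<Rightarrow> ((x + y) div 2, (x - y) div 2)) \<in> {p. ?e (2 * c) p = n}"
      using p E[of u v] by (auto simp: xy)
  qed auto
  also have "\<dots> = fps_nth (2 * (theta (2 * c))\<^sup>2) n"
    using c2 by (simp add: theta_def power2_eq_square[of "wgf _ _"] wgf_mult[OF f f] wgf_nth numeral_fps_const case_prod_unfold)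
  finally show "fps_nth ((theta c)\<^sup>2 + (theta_alt c)\<^sup>2) n = fps_nth (2 * (theta (2 * c))\<^sup>2) n" .
qed

text \<open>The inverse as pure algebra: \<open>1\<close> and \<open>2\<close> express squaring
  modulo 2, and \<open>3\<close> is \<open>theta_squares\<close> divided by 8.\<close>

lemma inverse_mod_64_ring:
  fixes S t p P P' :: "'a :: idom"
  assumes B: "B = 1 + 2 * S" and A: "A = B + 4 * p" and C: "C = 1 + 2 * t"
    and 1: "S\<^sup>2 = t + 2 * P" and 2: "t\<^sup>2 = S + p + 2 * P'"
    and 3: "(t - S) * (1 + S + t) = p * (1 + 2 * S + 2 * p)"
  shows "64 dvd B * (2 * B + 8 * A + 24 * C - 32 - 2 * A\<^sup>2 * B + B ^ 3) - 1"
proof -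
  \<comment> \<open>\<open>Z\<close> is the quotient by 64 that remains after reduction by the three
    relations; the identity that follows displays their multipliers.\<close>
  define Z where "Z = t + S * t + P - S * P - t * P - P\<^sup>2 - P' - 3 * p * S\<^sup>2 - 2 * p * S ^ 3 - 2 * p\<^sup>2 * S - 2 * p\<^sup>2 * S\<^sup>2"
  have "B * (2 * B + 8 * A + 24 * C - 32 - 2 * A\<^sup>2 * B + B ^ 3) - 1 = 64 * Z
    + (32 - 32 * S - 16 * (S\<^sup>2 + t + 2 * P)) * (S\<^sup>2 - (t + 2 * P)) - 32 * (t\<^sup>2 - (S + p + 2 * P'))
    + 16 * ((t - S) * (1 + S + t) - p * (1 + 2 * S + 2 * p))"
    unfolding A B C Z_def by algebra
  then have "B * (2 * B + 8 * A + 24 * C - 32 - 2 * A\<^sup>2 * B + B ^ 3) - 1 = 64 * Z"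
    unfolding 1 2 3 by simp
  then show ?thesis by simp
qed

lemma theta_alt_inverse_mod_64:
  assumes c: "c > 0"
  defines "A \<equiv> theta c" and "B \<equiv> theta_alt c" and "C \<equiv> theta (2 * c)"
  shows "64 dvd B * (2 * B + 8 * A + 24 * C - 32 - 2 * A\<^sup>2 * B + B ^ 3) - 1"
proof -
  \<comment> \<open>\<open>S\<close> and \<open>t\<close> are the halves of B - 1 and C - 1.
    \<open>p\<close> and \<open>r\<close> collect the odd and the even squares, so S = -p + r;
    moreover \<open>r\<close> is t^2 modulo 2.\<close>
  define S where "S = wgf (\<lambda>n. sg (int (Suc n))) (\<lambda>n. c * (Suc n)\<^sup>2)"
  define S' where "S' = wgf (\<lambda>_. 1) (\<lambda>n. c * (Suc n)\<^sup>2)"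
  define t where "t = wgf (\<lambda>_. 1) (\<lambda>n. 2 * c * (Suc n)\<^sup>2)"
  define r where "r = wgf (\<lambda>_. 1) (\<lambda>n. 4 * c * (Suc n)\<^sup>2)"
  define p where "p = wgf (\<lambda>_. 1) (\<lambda>n::nat. c * (2 * n + 1)\<^sup>2)"
  have B: "B = 1 + 2 * S"
    unfolding B_def theta_alt_def S_def using c by (intro wgf_even_square) auto
  have A: "A = 1 + 2 * S'"
    unfolding A_def theta_def S'_def using c by (intro wgf_even_square) auto
  have C: "C = 1 + 2 * t"
    unfolding C_def theta_def t_def using c by (intro wgf_even_square) auto
  have q: "c * (Suc (2 * n + 1))\<^sup>2 = 4 * c * (Suc n)\<^sup>2" for n
    by (simp add: power2_eq_square algebra_simps)
  have S': "S' = p + r"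
    unfolding S'_def p_def r_def wgf_nat_split[OF fin_fibres_Suc_square[OF c]] q by simp
  have neg: "wgf (\<lambda>_. - 1) e = - wgf (\<lambda>_. 1) e" for e :: "nat \<Rightarrow> nat"
    by (rule fps_ext) (simp add: wgf_nth)
  have s: "sg (int (Suc (2 * n + 1))) = 1" "sg (int (Suc (2 * n))) = - 1" for n
    by (auto simp: sg_def)
  have S: "S = - p + r"
    unfolding S_def p_def r_def wgf_nat_split[OF fin_fibres_Suc_square[OF c]] q s neg by simp
  obtain P where S2: "S\<^sup>2 = t + 2 * P"
    using wgf_square[OF fin_fibres_Suc_square[OF c], of "\<lambda>n. sg (int (Suc n))"]
    unfolding S_def t_def by (auto simp: power2_eq_square[of "sg _"] mult.assoc)
  obtain P' where t2: "t\<^sup>2 = r + 2 * P'"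
    using wgf_square[OF fin_fibres_Suc_square, of "2 * c" "\<lambda>n. 1"] c
    unfolding r_def t_def by (auto simp: mult.assoc)
  have "A\<^sup>2 + B\<^sup>2 = 2 * C\<^sup>2"
    unfolding A_def B_def C_def using c by (rule theta_squares)
  have A': "A = B + 4 * p"
    by (simp add: A B S' S)
  \<comment> \<open>This is A^2 + B^2 = 2 C^2 with A = B + 4p, B = 1 + 2S and C = 1 + 2t.\<close>
  have "8 * ((t - S) * (1 + S + t)) = 8 * (p * (1 + 2 * S + 2 * p))"
    using \<open>A\<^sup>2 + B\<^sup>2 = 2 * C\<^sup>2\<close> unfolding A' unfolding B C by (simp add: power2_eq_square algebra_simps)
  then have "(t - S) * (1 + S + t) = p * (1 + 2 * S + 2 * p)"
    by (simp only: mult_cancel_left) simp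
  moreover have "t\<^sup>2 = S + p + 2 * P'"
    using S t2 by simp
  ultimately show ?thesis
    using inverse_mod_64_ring[OF B A' C S2] by blast
qed

lemma EO_u_mod_64:
  "64 dvd EO_u M - (2 * fps_nth ((pent 1)\<^sup>2) M + 8 * fps_nth (pent 2 * theta 2) M
    + 24 * fps_nth (pent 2 * theta 4) M - 32 * fps_nth (pent 2) M
    - 2 * fps_nth ((pent 1)\<^sup>2 * (theta 2)\<^sup>2) M + fps_nth ((pent 1)\<^sup>2 * (theta_alt 2)\<^sup>2) M)"
proof -
  let ?E = "Abs_fps EO_u" and ?F = "pent 2" and ?A = "theta 2" and ?B = "theta_alt 2" and ?C = "theta 4"
  let ?G = "2 * ?B + 8 * ?A + 24 * ?C - 32 - 2 * ?A\<^sup>2 * ?B + ?B ^ 3"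
  have e: "eta_fps 2 = pent 1" "eta_fps 4 = ?F"
    using eta_fps_eq_pent[of 1] eta_fps_eq_pent[of 2] by simp_all
  have g: "(pent 1)\<^sup>2 = ?F * ?B"
    using gauss_theta[of 2] jtheta_eq_theta_alt[of 2] by (simp add: e)
  have "?F \<noteq> 0"
    using eta_fps_nth_0[of 4] unfolding e by force
  moreover have "?F * (?E * ?B) = ?F * ?F"
    using EO_u_gen_fun unfolding e g by (simp add: power2_eq_square mult_ac)
  ultimately have EB: "?E * ?B = ?F"
    by simp
  obtain Z where Z: "?B * ?G - 1 = 64 * Z"
    using theta_alt_inverse_mod_64[of 2] by (auto elim!: dvdE)
  \<comment> \<open>As F = E B, the error F G - E is E times the error B G - 1.\<close>
  have "?E - ?F * ?G = - ?E * (?B * ?G - 1)"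
    unfolding EB[symmetric] by (simp add: algebra_simps)
  then have "?E - ?F * ?G = 64 * (- ?E * Z)"
    unfolding Z by simp
  moreover have "?F * ?G = 2 * (pent 1)\<^sup>2 + 8 * (?F * ?A) + 24 * (?F * ?C) - 32 * ?F
     - 2 * ((pent 1)\<^sup>2 * ?A\<^sup>2) + (pent 1)\<^sup>2 * ?B\<^sup>2"
    unfolding g by algebra
  ultimately have "?E - (2 * (pent 1)\<^sup>2 + 8 * (?F * ?A) + 24 * (?F * ?C) - 32 * ?F
     - 2 * ((pent 1)\<^sup>2 * ?A\<^sup>2) + (pent 1)\<^sup>2 * ?B\<^sup>2) = 64 * (- ?E * Z)"
    by simp
  from arg_cong[OF this, of "\<lambda>f. fps_nth f M"] show ?thesis
    by (simp add: numeral_fps_const)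
qed

subsection \<open>Isotropic lines modulo 7\<close>

text \<open>-1 is not a square modulo 7; all residues are checked.\<close>

lemma seven_dvd_sum_squares:
  fixes u v :: int
  assumes "7 dvd u\<^sup>2 + v\<^sup>2"
  shows "7 dvd u \<and> 7 dvd v"
proof -
  have R: "{0..<7::int} = {0, 1, 2, 3, 4, 5, 6}"
    by auto
  have residues: "\<forall>a\<in>{0..<7::int}. \<forall>b\<in>{0..<7}. (a\<^sup>2 + b\<^sup>2) mod 7 = 0 \<longrightarrow> a = 0 \<and> b = 0"
    unfolding R by simp
  have "[(u mod 7)\<^sup>2 + (v mod 7)\<^sup>2 = u\<^sup>2 + v\<^sup>2] (mod 7)"
    by (intro cong_add cong_pow) (simp_all add: cong_def)
  then have "((u mod 7)\<^sup>2 + (v mod 7)\<^sup>2) mod 7 = 0"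
    using assms by (simp only: dvd_eq_mod_eq_0 cong_def)
  then have "u mod 7 = 0 \<and> v mod 7 = 0"
    using residues[rule_format, of "u mod 7" "v mod 7"] by simp
  then show ?thesis
    by (simp add: dvd_eq_mod_eq_0)
qed

text \<open>The eight elements r + si of norm 4 in the field with 49 elements. With these balanced
  representatives the set is literally stable under multiplication by i.\<close>

definition norm4_residues :: "(int \<times> int) set" where
  "norm4_residues = {(2, 0), (0, 2), (-2, 0), (0, -2), (3, 3), (-3, 3), (-3, -3), (3, -3)}"

lemma norm4_residues_ex:
  fixes p q :: int
  assumes "7 dvd p\<^sup>2 + q\<^sup>2 - 4"
  shows "\<exists>(r, s)\<in>norm4_residues. 7 dvd p - r \<and> 7 dvd q - s"
proof -
  have R: "{0..<7::int} = {0, 1, 2, 3, 4, 5, 6}"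
    by auto
  have residues: "\<forall>a\<in>{0..<7::int}. \<forall>b\<in>{0..<7}. (a\<^sup>2 + b\<^sup>2 - 4) mod 7 = 0 \<longrightarrow>
      (\<exists>(r, s)\<in>norm4_residues. (a - r) mod 7 = 0 \<and> (b - s) mod 7 = 0)"
    unfolding R norm4_residues_def by simp
  have "[(p mod 7)\<^sup>2 + (q mod 7)\<^sup>2 - 4 = p\<^sup>2 + q\<^sup>2 - 4] (mod 7)"
    by (intro cong_add cong_diff cong_pow) (simp_all add: cong_def)
  then have "((p mod 7)\<^sup>2 + (q mod 7)\<^sup>2 - 4) mod 7 = 0"
    using assms by (simp only: dvd_eq_mod_eq_0 cong_def)
  then have "\<exists>(r, s)\<in>norm4_residues. (p mod 7 - r) mod 7 = 0 \<and> (q mod 7 - s) mod 7 = 0"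
    by (intro residues[rule_format]) simp_all
  then show ?thesis
    by (simp add: mod_simps dvd_eq_mod_eq_0)
qed

text \<open>
  With \<open>z = x + y\<i>\<close>, \<open>w = a + b\<i>\<close> and \<open>c = r + s\<i>\<close> this is the congruence \<open>z = c w\<close> modulo 7.
\<close>
definition slope7 :: "int \<times> int \<Rightarrow> int \<Rightarrow> int \<Rightarrow> int \<Rightarrow> int \<Rightarrow> bool" where
  "slope7 = (\<lambda>(r, s) x y a b. 7 dvd x - (r * a - s * b) \<and> 7 dvd y - (s * a + r * b))"

text \<open>The slope is z / w: the norm of w is prime to 7, so w is invertible, and the congruence
  of norms gives the quotient norm 4.\<close>

lemma slope7_ex:
  assumes "7 dvd x\<^sup>2 + y\<^sup>2 - 4 * (a\<^sup>2 + b\<^sup>2)" and ab: "\<not> (7 dvd a \<and> 7 dvd b)"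
  shows "\<exists>c\<in>norm4_residues. slope7 c x y a b"
proof -
  define n where "n = a\<^sup>2 + b\<^sup>2"
  have "\<not> 7 dvd n"
    using seven_dvd_sum_squares[of a b] ab unfolding n_def by blast
  then have "coprime 7 n"
    by (intro prime_imp_coprime) simp_all
  then have "coprime n 7"
    by (simp only: coprime_commute)
  then obtain m where "[n * m = 1] (mod 7)"
    using coprime_iff_invertible_int by blast
  then have nm: "7 dvd n * m - 1"
    by (simp add: cong_iff_dvd_diff)
  \<comment> \<open>p + qi is z times the conjugate of w times the inverse \<open>m\<close> of
    |w|^2.\<close>
  define p q where "p = (x * a + y * b) * m" and "q = (y * a - x * b) * m"
  have "p\<^sup>2 + q\<^sup>2 - 4 = (x\<^sup>2 + y\<^sup>2 - 4 * (a\<^sup>2 + b\<^sup>2)) * (n * m\<^sup>2) + 4 * (n * m + 1) * (n * m - 1)"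
    unfolding p_def q_def n_def by algebra
  then have "7 dvd p\<^sup>2 + q\<^sup>2 - 4"
    using assms(1) nm by (simp add: dvd_add)
  from norm4_residues_ex[OF this] obtain r s where rs: "(r, s) \<in> norm4_residues" "7 dvd p - r" "7 dvd q - s"
    by auto
  have "x - (r * a - s * b) = (p - r) * a - (q - s) * b - x * (n * m - 1)"
    "y - (s * a + r * b) = (q - s) * a + (p - r) * b - y * (n * m - 1)"
    unfolding p_def q_def n_def by algebra+
  moreover have "7 dvd (q - s) * a + (p - r) * b - y * (n * m - 1)"
    "7 dvd (p - r) * a - (q - s) * b - x * (n * m - 1)"
    using rs nm by simp_all
  ultimately have "slope7 (r, s) x y a b"
    by (simp add: slope7_def)
  then show ?thesis
    using rs(1) by blast
qed

text \<open>(c - c') w = 0 modulo 7 with w invertible, and the eight representatives are distinct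
  modulo 7.\<close>

lemma slope7_unique:
  assumes "slope7 c x y a b" "slope7 c' x y a b" "c \<in> norm4_residues" "c' \<in> norm4_residues" "\<not> (7 dvd a \<and> 7 dvd b)"
  shows "c = c'"
proof -
  obtain r s r' s' where c: "c = (r, s)" "c' = (r', s')"
    by (cases c, cases c')
  have d: "7 dvd x - (r * a - s * b)" "7 dvd y - (s * a + r * b)"
    "7 dvd x - (r' * a - s' * b)" "7 dvd y - (s' * a + r' * b)"
    using assms(1,2) by (auto simp: c slope7_def)
  have *: "7 dvd (r - r') * a - (s - s') * b" "7 dvd (s - s') * a + (r - r') * b"
    using dvd_diff[OF d(3) d(1)] dvd_diff[OF d(4) d(2)] by (simp_all add: algebra_simps)
  have n: "\<not> 7 dvd a\<^sup>2 + b\<^sup>2"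
    using seven_dvd_sum_squares[of a b] assms(5) by blast
  have "(r - r') * (a\<^sup>2 + b\<^sup>2) = ((r - r') * a - (s - s') * b) * a + ((s - s') * a + (r - r') * b) * b"
    "(s - s') * (a\<^sup>2 + b\<^sup>2) = ((s - s') * a + (r - r') * b) * a - ((r - r') * a - (s - s') * b) * b"
    by algebra+
  then have "7 dvd (r - r') * (a\<^sup>2 + b\<^sup>2)" "7 dvd (s - s') * (a\<^sup>2 + b\<^sup>2)"
    using * by simp_all
  then have "7 dvd r - r'" "7 dvd s - s'"
    using n by (auto dest!: prime_dvd_multD[of "7::int", rotated])
  then show ?thesis
    using assms(3,4) unfolding c norm4_residues_def by auto
qed

lemma seven_dvd_odd: "(7::int) dvd 6 * j - 1 - 2 * a \<Longrightarrow> \<exists>m. 6 * j - 1 - 2 * a = 7 * (2 * m + 1)"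
proof -
  assume "7 dvd 6 * j - 1 - 2 * a"
  then obtain k where k: "6 * j - 1 - 2 * a = 7 * k"
    by (elim dvdE)
  moreover have "odd (6 * j - 1 - 2 * a)"
    by simp
  then have "odd k"
    unfolding k by simp
  ultimately show ?thesis
    by (auto elim!: oddE)
qed

lemma six_minus_one_square: "(6 * j - 1)\<^sup>2 = 12 * int (nat (j * (3 * j - 1))) + 1"
  using pent_exp_nonneg[of j] by (simp add: power2_eq_square algebra_simps)

lemma abs_square: "a\<^sup>2 = int (nat \<bar>a\<bar> ^ 2)"
  by simp

section \<open>Coefficients as sums over quadratic forms\<close>

definition quad4 :: "nat \<Rightarrow> ((int \<times> int) \<times> (int \<times> int)) set" where
  "quad4 N = {((j, l), (a, b)). (6 * j - 1)\<^sup>2 + (6 * l - 1)\<^sup>2 + 24 * (a\<^sup>2 + b\<^sup>2) = int N}"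

definition quad2 :: "nat \<Rightarrow> nat \<Rightarrow> (int \<times> int) set" where
  "quad2 d N = {(j, a). (6 * j - 1)\<^sup>2 + int d * a\<^sup>2 = int N}"

text \<open>Completing squares: 12 times the exponent plus 2 is the value of the quaternary
  form.\<close>

lemma quad4_fibre:
  "quad4 (12 * M + 2) = {p. (case p of (i, k) \<Rightarrow>
      (case i of (j, l) \<Rightarrow> 1 * nat (j * (3 * j - 1)) + 1 * nat (l * (3 * l - 1))) +
      (case k of (a, b) \<Rightarrow> 2 * nat \<bar>a\<bar> ^ 2 + 2 * nat \<bar>b\<bar> ^ 2)) = M}"
proof -
  have "(6 * j - 1)\<^sup>2 + (6 * l - 1)\<^sup>2 + 24 * (a\<^sup>2 + b\<^sup>2) = int (12 * M + 2) \<longleftrightarrow>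
      1 * nat (j * (3 * j - 1)) + 1 * nat (l * (3 * l - 1)) + (2 * nat \<bar>a\<bar> ^ 2 + 2 * nat \<bar>b\<bar> ^ 2) = M"
    (is "?l = _ \<longleftrightarrow> ?X = M") for j l a b
  proof -
    have "?l = int (12 * ?X + 2)"
      unfolding six_minus_one_square abs_square[of a] abs_square[of b] by (simp add: algebra_simps)
    moreover have "12 * X + 2 = 12 * M + 2 \<longleftrightarrow> X = M" for X :: nat
      by simp
    ultimately show ?thesis
      by (simp only: of_nat_eq_iff)
  qed
  then show ?thesis
    by (auto simp: quad4_def simp del: mult_1 nat_mult_1)
qed

lemma fin_fibres_quad4: "fin_fibres (\<lambda>(i, k).
      (case i of (j, l) \<Rightarrow> 1 * nat (j * (3 * j - 1)) + 1 * nat (l * (3 * l - 1))) +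
      (case k of (a, b) \<Rightarrow> 2 * nat \<bar>a\<bar> ^ 2 + 2 * nat \<bar>b\<bar> ^ 2))"
  by (intro fin_fibres_pair fin_fibres_pent fin_fibres_square) simp_all

lemma finite_quad4: "finite (quad4 (12 * M + 2))"
  unfolding quad4_fibre by (rule fin_fibresD[OF fin_fibres_quad4])

lemma pent_square_theta_square_nth:
  "fps_nth ((pent 1)\<^sup>2 * (wgf v (\<lambda>k. 2 * nat \<bar>k\<bar> ^ 2))\<^sup>2) M =
    (\<Sum>((j, l), (a, b))\<in>quad4 (12 * M + 2). sg j * sg l * (v a * v b))"
proof -
  have 1: "pent 1 * pent 1 = wgf (\<lambda>(j, l). sg j * sg l)
      (\<lambda>(j, l). 1 * nat (j * (3 * j - 1)) + 1 * nat (l * (3 * l - 1)))"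
    unfolding pent_def by (rule wgf_mult[OF fin_fibres_pent fin_fibres_pent]) simp_all
  have 2: "wgf v (\<lambda>k. 2 * nat \<bar>k\<bar> ^ 2) * wgf v (\<lambda>k. 2 * nat \<bar>k\<bar> ^ 2) =
      wgf (\<lambda>(a, b). v a * v b) (\<lambda>(a, b). 2 * nat \<bar>a\<bar> ^ 2 + 2 * nat \<bar>b\<bar> ^ 2)"
    by (rule wgf_mult[OF fin_fibres_square fin_fibres_square]) simp_all
  have "(pent 1)\<^sup>2 * (wgf v (\<lambda>k. 2 * nat \<bar>k\<bar> ^ 2))\<^sup>2 =
    wgf (\<lambda>(i, k). (case i of (j, l) \<Rightarrow> sg j * sg l) * (case k of (a, b) \<Rightarrow> v a * v b))
     (\<lambda>(i, k).
      (case i of (j, l) \<Rightarrow> 1 * nat (j * (3 * j - 1)) + 1 * nat (l * (3 * l - 1))) +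
      (case k of (a, b) \<Rightarrow> 2 * nat \<bar>a\<bar> ^ 2 + 2 * nat \<bar>b\<bar> ^ 2))"
    unfolding power2_eq_square[of "pent 1"] power2_eq_square[of "wgf _ _"] 1 2
    by (intro wgf_mult fin_fibres_pair fin_fibres_pent fin_fibres_square) simp_all
  then show ?thesis
    by (simp only: wgf_nth quad4_fibre) (intro sum.cong; auto)
qed

lemma pent_theta_nth:
  assumes c: "c > 0"
  shows "fps_nth (pent 2 * wgf v (\<lambda>k. c * nat \<bar>k\<bar> ^ 2)) M = (\<Sum>(j, a)\<in>quad2 (6 * c) (6 * M + 1). sg j * v a)"
proof -
  have "(6 * j - 1)\<^sup>2 + int (6 * c) * a\<^sup>2 = int (6 * M + 1) \<longleftrightarrow> 2 * nat (j * (3 * j - 1)) + c * nat \<bar>a\<bar> ^ 2 = M"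
    (is "?l = _ \<longleftrightarrow> ?X = M") for j a
  proof -
    have "?l = int (6 * ?X + 1)"
      unfolding six_minus_one_square abs_square[of a] by (simp add: algebra_simps)
    moreover have "6 * X + 1 = 6 * M + 1 \<longleftrightarrow> X = M" for X :: nat
      by simp
    ultimately show ?thesis
      by (simp only: of_nat_eq_iff)
  qed
  then have "quad2 (6 * c) (6 * M + 1) = {p. (case p of (j, a) \<Rightarrow> 2 * nat (j * (3 * j - 1)) + c * nat \<bar>a\<bar> ^ 2) = M}"
    by (auto simp: quad2_def)
  then show ?thesis
    unfolding pent_def by (subst wgf_mult[OF fin_fibres_pent fin_fibres_square[OF c]]) (simp_all add: wgf_nth)
qed

section \<open>Symmetries and descent on the isotropic lines\<close>

lemma sum_eq_0_involution:
  fixes g :: "'a \<Rightarrow> int"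
  assumes "\<And>x. x \<in> A \<Longrightarrow> f x \<in> A \<and> f (f x) = x \<and> g (f x) = - g x"
  shows "sum g A = 0"
proof -
  have "sum g A = (\<Sum>x\<in>A. - g x)"
    by (rule sum.reindex_bij_witness[of _ f f]) (use assms in auto)
  then show ?thesis
    by (simp add: sum_negf)
qed

definition slope_class :: "int \<times> int \<Rightarrow> ((int \<times> int) \<times> (int \<times> int)) set" where
  "slope_class c = {((j, l), (a, b)). slope7 c (6 * j - 1) (6 * l - 1) a b}"

text \<open>Passing from w to iw turns the line z = icw into z = cw and keeps |w|. The condition on
  \<open>h\<close>, met by constants and by \<open>sg\<close>, makes the weight invariant.\<close>

lemma sum_slope_class_rotate:
  fixes h :: "int \<Rightarrow> int"
  assumes h: "\<And>a b. h (b - a) = h (a + b)"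
  shows "(\<Sum>((j, l), (a, b))\<in>quad4 N \<inter> slope_class (- s, r). sg j * sg l * h (a + b)) =
         (\<Sum>((j, l), (a, b))\<in>quad4 N \<inter> slope_class (r, s). sg j * sg l * h (a + b))"
proof (rule sum.reindex_bij_witness[of _
    "\<lambda>((j :: int, l :: int), (a :: int, b :: int)). ((j, l), (b, - a))"
    "\<lambda>((j, l), (a, b)). ((j, l), (- b, a))"])
  have rot: "slope7 (- s, r) x y a b \<longleftrightarrow> slope7 (r, s) x y (- b) a" for x y a b
  proof -
    have e: "- s * a - r * b = r * - b - s * a" "r * a + - s * b = s * - b + r * a"
      by simp_all
    show ?thesis
      by (simp only: slope7_def prod.case e)
  qed
  show "(\<lambda>((j, l), (a, b)). ((j, l), (- b, a))) p \<in> quad4 N \<inter> slope_class (r, s)"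
    if "p \<in> quad4 N \<inter> slope_class (- s, r)" for p
    using that by (auto simp: quad4_def slope_class_def rot add.commute)
  show "(\<lambda>((j, l), (a, b)). ((j, l), (b, - a))) p \<in> quad4 N \<inter> slope_class (- s, r)"
    if "p \<in> quad4 N \<inter> slope_class (r, s)" for p
    using that by (auto simp: quad4_def slope_class_def rot add.commute)
qed (auto simp: h[symmetric] split: prod.splits)

text \<open>
  The involution is \<open>s \<mapsto> -s\<close> in the coordinates \<open>x = 3s + 4k\<close>, \<open>a - b = s - k\<close>, with \<open>y\<close> and \<open>a + b\<close> fixed.
  It changes \<open>j\<close> by the odd number \<open>s\<close>.
\<close>
lemma sum_slope_3_3:
  "(\<Sum>((j, l), (a, b))\<in>quad4 N \<inter> slope_class (3, 3). sg j * sg l * h (a + b)) = (0 :: int)"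
proof (rule sum_eq_0_involution[of _ "\<lambda>((j :: int, l :: int), (a :: int, b :: int)).
    let s = (6 * j - 1 + 4 * (a - b)) div 7 in ((j - s, l), (a - s, b + s))"])
  fix p :: "(int \<times> int) \<times> (int \<times> int)"
  assume p: "p \<in> quad4 N \<inter> slope_class (3, 3)"
  obtain j l a b where jl: "p = ((j, l), (a, b))"
    by (cases p) auto
  have e: "(6 * j - 1)\<^sup>2 + (6 * l - 1)\<^sup>2 + 24 * (a\<^sup>2 + b\<^sup>2) = int N"
    and d: "7 dvd 6 * j - 1 - (3 * a - 3 * b)" "7 dvd 6 * l - 1 - (3 * a + 3 * b)"
    using p by (auto simp: jl quad4_def slope_class_def slope7_def)
  have "7 dvd (6 * j - 1 - (3 * a - 3 * b)) + 7 * (a - b)"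
    using d(1) by (rule dvd_add) simp
  also have "(6 * j - 1 - (3 * a - 3 * b)) + 7 * (a - b) = 6 * j - 1 + 4 * (a - b)"
    by simp
  finally have "7 dvd 6 * j - 1 + 4 * (a - b)" .
  then obtain s where s: "6 * j - 1 + 4 * (a - b) = 7 * s"
    by (elim dvdE)
  have "odd (6 * j - 1 + 4 * (a - b))"
    by simp
  then have odd: "odd s"
    unfolding s by simp
  have s': "6 * (j - s) - 1 + 4 * (a - s - (b + s)) = 7 * (- s)"
    using s by simp
  have "(6 * (j - s) - 1)\<^sup>2 + (6 * l - 1)\<^sup>2 + 24 * ((a - s)\<^sup>2 + (b + s)\<^sup>2) = int N"
  proof -
    have "(6 * (j - s) - 1)\<^sup>2 + (6 * l - 1)\<^sup>2 + 24 * ((a - s)\<^sup>2 + (b + s)\<^sup>2) =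
        (6 * j - 1)\<^sup>2 + (6 * l - 1)\<^sup>2 + 24 * (a\<^sup>2 + b\<^sup>2) - 12 * s * (6 * j - 1 + 4 * (a - b) - 7 * s)"
      by (simp add: power2_eq_square algebra_simps)
    then show ?thesis
      unfolding e s by simp
  qed
  moreover have "6 * (j - s) - 1 - (3 * (a - s) - 3 * (b + s)) = 7 * (s - (a - b))"
    using s by simp
  then have "7 dvd 6 * (j - s) - 1 - (3 * (a - s) - 3 * (b + s))"
    by (rule dvdI)
  moreover have "7 dvd 6 * l - 1 - (3 * (a - s) + 3 * (b + s))"
    using d(2) by (simp add: algebra_simps)
  ultimately have "((j - s, l), (a - s, b + s)) \<in> quad4 N \<inter> slope_class (3, 3)"
    by (simp only: quad4_def slope_class_def slope7_def mem_Collect_eq Int_iff prod.case)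
  moreover have "sg (j - s) = - sg j"
    using odd by (auto simp: sg_def)
  ultimately show "(\<lambda>((j, l), (a, b)). let s = (6 * j - 1 + 4 * (a - b)) div 7 in ((j - s, l), (a - s, b + s))) p
      \<in> quad4 N \<inter> slope_class (3, 3) \<and>
     (\<lambda>((j, l), (a, b)). let s = (6 * j - 1 + 4 * (a - b)) div 7 in ((j - s, l), (a - s, b + s)))
      ((\<lambda>((j, l), (a, b)). let s = (6 * j - 1 + 4 * (a - b)) div 7 in ((j - s, l), (a - s, b + s))) p) = p \<and>
     (\<lambda>((j, l), (a, b)). sg j * sg l * h (a + b))
      ((\<lambda>((j, l), (a, b)). let s = (6 * j - 1 + 4 * (a - b)) div 7 in ((j - s, l), (a - s, b + s))) p) =
     - (\<lambda>((j, l), (a, b)). sg j * sg l * h (a + b)) p"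
    unfolding jl prod.case Let_def s nonzero_mult_div_cancel_left[OF zero_neq_numeral[symmetric]] s' by simp
qed

text \<open>
  The involution is \<open>k \<mapsto> -k\<close> in the coordinates \<open>x = s + 6k\<close>, \<open>2a = s - k\<close>; it changes \<open>a\<close> by the odd number \<open>k\<close>.
\<close>
lemma sum_slope_2_0_alt:
  "(\<Sum>((j, l), (a, b))\<in>quad4 N \<inter> slope_class (2, 0). sg j * sg l * sg (a + b)) = 0"
proof (rule sum_eq_0_involution[of _ "\<lambda>((j :: int, l :: int), (a :: int, b :: int)).
    let k = (6 * j - 1 - 2 * a) div 7 in ((j - 2 * k, l), (a + k, b))"])
  fix p :: "(int \<times> int) \<times> (int \<times> int)"
  assume p: "p \<in> quad4 N \<inter> slope_class (2, 0)"
  obtain j l a b where jl: "p = ((j, l), (a, b))"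
    by (cases p) auto
  have e: "(6 * j - 1)\<^sup>2 + (6 * l - 1)\<^sup>2 + 24 * (a\<^sup>2 + b\<^sup>2) = int N"
    and d: "7 dvd 6 * j - 1 - 2 * a" "7 dvd 6 * l - 1 - 2 * b"
    using p by (auto simp: jl quad4_def slope_class_def slope7_def)
  obtain k where k: "6 * j - 1 - 2 * a = 7 * k"
    using d(1) by (elim dvdE)
  have "odd (6 * j - 1 - 2 * a)"
    by simp
  then have odd: "odd k"
    unfolding k by simp
  have k': "6 * (j - 2 * k) - 1 - 2 * (a + k) = 7 * (- k)"
    using k by simp
  have "(6 * (j - 2 * k) - 1)\<^sup>2 + (6 * l - 1)\<^sup>2 + 24 * ((a + k)\<^sup>2 + b\<^sup>2) = int N"
  proof -
    have "(6 * (j - 2 * k) - 1)\<^sup>2 + (6 * l - 1)\<^sup>2 + 24 * ((a + k)\<^sup>2 + b\<^sup>2) =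
        (6 * j - 1)\<^sup>2 + (6 * l - 1)\<^sup>2 + 24 * (a\<^sup>2 + b\<^sup>2) - 24 * k * (6 * j - 1 - 2 * a - 7 * k)"
      by (simp add: power2_eq_square algebra_simps)
    then show ?thesis
      unfolding e k by simp
  qed
  moreover have "7 dvd 6 * (j - 2 * k) - 1 - 2 * (a + k)"
    unfolding k' by simp
  ultimately have "((j - 2 * k, l), (a + k, b)) \<in> quad4 N \<inter> slope_class (2, 0)"
    using d(2) by (simp add: quad4_def slope_class_def slope7_def)
  moreover have "sg (j - 2 * k) = sg j" "sg (a + k + b) = - sg (a + b)"
    using odd by (auto simp: sg_def)
  ultimately show "(\<lambda>((j, l), (a, b)). let k = (6 * j - 1 - 2 * a) div 7 in ((j - 2 * k, l), (a + k, b))) p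
      \<in> quad4 N \<inter> slope_class (2, 0) \<and>
     (\<lambda>((j, l), (a, b)). let k = (6 * j - 1 - 2 * a) div 7 in ((j - 2 * k, l), (a + k, b)))
      ((\<lambda>((j, l), (a, b)). let k = (6 * j - 1 - 2 * a) div 7 in ((j - 2 * k, l), (a + k, b))) p) = p \<and>
     (\<lambda>((j, l), (a, b)). sg j * sg l * sg (a + b))
      ((\<lambda>((j, l), (a, b)). let k = (6 * j - 1 - 2 * a) div 7 in ((j - 2 * k, l), (a + k, b))) p) =
     - (\<lambda>((j, l), (a, b)). sg j * sg l * sg (a + b)) p"
    unfolding jl prod.case Let_def k nonzero_mult_div_cancel_left[OF zero_neq_numeral[symmetric]] k' by simp
qed

text \<open>
  With \<open>x = 6j - 1\<close>, \<open>s = 6i - 1\<close> and \<open>k = 2m + 1\<close> this is the substitution \<open>x = s + 6k\<close>, \<open>2a = s - k\<close>, for which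
  \<open>x - 2a = 7k\<close> and \<open>x\<^sup>2 + 24a\<^sup>2 = 7(s\<^sup>2 + 6k\<^sup>2)\<close>.
\<close>
definition descent :: "int \<times> int \<Rightarrow> int \<times> int" where
  "descent = (\<lambda>(i, m). (i + 2 * m + 1, 3 * i - 1 - m))"

lemma inj_descent: "inj descent"
  by (auto simp: inj_def descent_def)

lemma descent_iff: "7 dvd 6 * j - 1 - 2 * a \<longleftrightarrow> (j, a) \<in> range descent"
proof
  assume "7 dvd 6 * j - 1 - 2 * a"
  then obtain m where m: "6 * j - 1 - 2 * a = 7 * (2 * m + 1)"
    using seven_dvd_odd by blast
  then have "(j, a) = descent (j - 2 * m - 1, m)"
    by (simp add: descent_def)
  then show "(j, a) \<in> range descent"
    by blast
next
  assume "(j, a) \<in> range descent"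
  then obtain i m where "j = i + 2 * m + 1" "a = 3 * i - 1 - m"
    by (auto simp: descent_def)
  then have "6 * j - 1 - 2 * a = 7 * (2 * m + 1)"
    by simp
  then show "7 dvd 6 * j - 1 - 2 * a"
    by (rule dvdI)
qed

definition desc_exp :: "int \<times> int \<Rightarrow> nat" where
  "desc_exp = (\<lambda>(i, m). nat \<bar>6 * i - 1\<bar> ^ 2 + 6 * nat \<bar>2 * m + 1\<bar> ^ 2)"

text \<open>The sign changes because j - i = 2m + 1 is odd.\<close>

lemma descent_norm:
  assumes "descent p = (j, a)"
  shows "(6 * j - 1)\<^sup>2 + 24 * a\<^sup>2 = 7 * int (desc_exp p)" "sg j = - sg (fst p)"
proof -
  obtain i m where p: "p = (i, m)"
    by (cases p)
  have j: "j = i + 2 * m + 1" and a: "a = 3 * i - 1 - m"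
    using assms by (simp_all add: p descent_def)
  show "(6 * j - 1)\<^sup>2 + 24 * a\<^sup>2 = 7 * int (desc_exp p)"
    unfolding j a by (simp add: p desc_exp_def power2_eq_square algebra_simps)
  show "sg j = - sg (fst p)"
    unfolding j by (simp add: p sg_def)
qed

lemma fin_fibres_desc1: "fin_fibres (\<lambda>i::int. nat \<bar>6 * i - 1\<bar> ^ 2)"
proof (rule fin_fibres_int)
  fix i :: int
  have "nat \<bar>i\<bar> \<le> nat \<bar>6 * i - 1\<bar>"
    by (cases "i \<ge> 1") auto
  also have "\<dots> \<le> 1 * nat \<bar>6 * i - 1\<bar> ^ 2"
    by (rule le_mult_square) simp
  finally show "nat \<bar>i\<bar> \<le> nat \<bar>6 * i - 1\<bar> ^ 2"
    by simp
qed

lemma fin_fibres_desc2: "fin_fibres (\<lambda>m::int. 6 * nat \<bar>2 * m + 1\<bar> ^ 2)"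
proof (rule fin_fibres_int)
  fix m :: int
  have "nat \<bar>m\<bar> \<le> nat \<bar>2 * m + 1\<bar>"
    by (cases "m \<ge> 0") auto
  also have "\<dots> \<le> 6 * nat \<bar>2 * m + 1\<bar> ^ 2"
    by (rule le_mult_square) simp
  finally show "nat \<bar>m\<bar> \<le> 6 * nat \<bar>2 * m + 1\<bar> ^ 2" .
qed

text \<open>Keeping only k = 2m + 1 > 0 halves the series over \<open>desc_exp\<close>; the factors
  2 taken out this way count in the divisibility by 64.\<close>

definition Psi :: "int fps" where
  "Psi = wgf (\<lambda>(i, m). sg i) (\<lambda>(i, m::nat). nat \<bar>6 * i - 1\<bar> ^ 2 + 6 * (2 * m + 1)\<^sup>2)"

lemma fin_fibres_Psi: "fin_fibres (\<lambda>(i :: int, m::nat). nat \<bar>6 * i - 1\<bar> ^ 2 + 6 * (2 * m + 1)\<^sup>2)"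
  by (intro fin_fibres_pair fin_fibres_desc1 fin_fibres_odd_square) simp

lemma fin_fibres_desc_exp: "fin_fibres desc_exp"
  unfolding desc_exp_def by (intro fin_fibres_pair fin_fibres_desc1 fin_fibres_desc2)

lemma wgf_desc_exp: "wgf (\<lambda>p. sg (fst p)) desc_exp = 2 * Psi"
proof -
  let ?X = "wgf sg (\<lambda>i. nat \<bar>6 * i - 1\<bar> ^ 2)"
  let ?Y = "wgf (\<lambda>_. 1) (\<lambda>m::int. 6 * nat \<bar>2 * m + 1\<bar> ^ 2)"
  let ?Z = "wgf (\<lambda>_. 1) (\<lambda>m::nat. 6 * (2 * m + 1)\<^sup>2)"
  have e: "6 * nat \<bar>2 * int m + 1\<bar> ^ 2 = 6 * (2 * m + 1)\<^sup>2"
    "6 * nat \<bar>2 * (- 1 - int m) + 1\<bar> ^ 2 = 6 * (2 * m + 1)\<^sup>2" for m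
  proof -
    have "2 * int m + 1 = int (2 * m + 1)" "2 * (- 1 - int m) + 1 = - int (2 * m + 1)"
      by simp_all
    then show "6 * nat \<bar>2 * int m + 1\<bar> ^ 2 = 6 * (2 * m + 1)\<^sup>2"
      "6 * nat \<bar>2 * (- 1 - int m) + 1\<bar> ^ 2 = 6 * (2 * m + 1)\<^sup>2"
      by (simp_all only: abs_minus_cancel abs_of_nat nat_int)
  qed
  have "wgf (\<lambda>p. sg (fst p)) desc_exp = ?X * ?Y"
    unfolding desc_exp_def by (subst wgf_mult[OF fin_fibres_desc1 fin_fibres_desc2]) (simp add: case_prod_unfold)
  also have "?Y = 2 * ?Z"
    unfolding wgf_int_split[OF fin_fibres_desc2] e by simp
  also have "?X * (2 * ?Z) = 2 * (?X * ?Z)"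
    by simp
  also have "?X * ?Z = Psi"
    unfolding Psi_def by (subst wgf_mult[OF fin_fibres_desc1 fin_fibres_odd_square]) (simp_all add: case_prod_unfold)
  finally show ?thesis .
qed

text \<open>\<open>wgf_square\<close> leaves the diagonal, which at index 2n runs over the fibre of
  [Psi]_n; its weights are squares of \<open>sg\<close>, congruent to \<open>sg\<close> modulo
  2.\<close>

lemma Psi_square_parity: "2 dvd fps_nth (Psi\<^sup>2) (2 * n) - fps_nth Psi n"
proof -
  let ?e = "\<lambda>(i :: int, m::nat). nat \<bar>6 * i - 1\<bar> ^ 2 + 6 * (2 * m + 1)\<^sup>2"
  obtain P where P: "Psi\<^sup>2 = wgf (\<lambda>p. (case p of (i, m) \<Rightarrow> sg i)\<^sup>2) (\<lambda>p. 2 * ?e p) + 2 * P"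
    unfolding Psi_def using wgf_square[OF fin_fibres_Psi] by blast
  have fib: "{p. 2 * ?e p = 2 * n} = {p. ?e p = n}"
    by (simp only: mult_cancel_left) simp
  have "fps_nth (Psi\<^sup>2) (2 * n) - fps_nth Psi n =
      (\<Sum>p | ?e p = n. (sg (fst p))\<^sup>2 - sg (fst p)) + 2 * fps_nth P (2 * n)"
    unfolding P fps_add_nth wgf_nth fib by (simp add: Psi_def wgf_nth numeral_fps_const sum_subtractf case_prod_unfold)
  moreover have "2 dvd (sg k)\<^sup>2 - sg k" for k
    by (simp add: sg_def)
  then have "2 dvd (\<Sum>p | ?e p = n. (sg (fst p))\<^sup>2 - sg (fst p))"
    by (intro dvd_sum)
  ultimately show ?thesis
    by simp
qed

section \<open>Coefficients of q^M for 6M + 1 = 7n with n prime to 7\<close>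

context
  fixes M n :: nat
  assumes Mn: "6 * M + 1 = 7 * n" and n: "\<not> 7 dvd n"
begin

lemma not_49_dvd: "int (7 * n) = u\<^sup>2 + int d * v\<^sup>2 \<Longrightarrow> \<not> (7 dvd u \<and> 7 dvd v)"
proof
  assume e: "int (7 * n) = u\<^sup>2 + int d * v\<^sup>2" and "7 dvd u \<and> 7 dvd v"
  then obtain u' v' where "u = 7 * u'" "v = 7 * v'"
    by (auto elim!: dvdE)
  then have "int n = 7 * (u'\<^sup>2 + int d * v'\<^sup>2)"
    using e by (simp add: power2_eq_square algebra_simps)
  then have "int 7 dvd int n"
    by simp
  then show False
    using n by (simp only: int_dvd_int_iff)
qed

lemma pent_nth_0: "fps_nth (pent 2) M = 0"
proof -
  have "2 * nat (j * (3 * j - 1)) \<noteq> M" for j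
  proof
    assume "2 * nat (j * (3 * j - 1)) = M"
    then have "(6 * j - 1)\<^sup>2 = int (7 * n)"
      unfolding Mn[symmetric] six_minus_one_square by auto
    moreover from this have "7 dvd (6 * j - 1)\<^sup>2"
      by simp
    then have "7 dvd 6 * j - 1"
      by (rule prime_dvd_power[rotated]) simp
    ultimately show False
      using not_49_dvd[of "6 * j - 1" 0 0] by simp
  qed
  then show ?thesis
    by (simp add: pent_def wgf_nth)
qed

text \<open>A contributing pair would write 14n as a sum of two squares; 7 would divide both roots,
  hence 49 would divide 14n.\<close>

lemma pent_square_nth_0: "fps_nth ((pent 1)\<^sup>2) M = 0"
proof -
  have "nat (j * (3 * j - 1)) + nat (l * (3 * l - 1)) \<noteq> M" for j l
  proof
    assume "nat (j * (3 * j - 1)) + nat (l * (3 * l - 1)) = M"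
    then have e: "(6 * j - 1)\<^sup>2 + (6 * l - 1)\<^sup>2 = 2 * int (7 * n)"
      unfolding Mn[symmetric] six_minus_one_square by auto
    then have "7 dvd (6 * j - 1)\<^sup>2 + (6 * l - 1)\<^sup>2"
      by simp
    then have "7 dvd 6 * j - 1" "7 dvd 6 * l - 1"
      using seven_dvd_sum_squares by blast+
    then obtain u v where "6 * j - 1 = 7 * u" "6 * l - 1 = 7 * v"
      by (auto elim!: dvdE)
    then have "2 * int n = 7 * (u\<^sup>2 + v\<^sup>2)"
      using e by (simp add: power2_eq_square algebra_simps)
    \<comment> \<open>4 inverts 2 modulo 7.\<close>
    then have "int n = 7 * (4 * (u\<^sup>2 + v\<^sup>2) - int n)"
      by simp
    then have "7 dvd int n"
      by (rule dvdI)
    then have "int 7 dvd int n"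
      by simp
    then show False
      using n by (simp only: int_dvd_int_iff)
  qed
  then show ?thesis
    unfolding power2_eq_square pent_def
    by (subst wgf_mult[OF fin_fibres_pent fin_fibres_pent]) (auto simp: wgf_nth intro!: sum.neutral)
qed

text \<open>As j (3j - 1) is even, \<open>a\<close> has the parity of M / 2 on the whole fibre. So
  \<open>theta 2\<close> and \<open>theta_alt 2\<close> give the same coefficient up to sign, and
  the latter yields that of f_2^2 by Gauss's identity.\<close>

lemma pent_theta2_nth_0: "fps_nth (pent 2 * theta 2) M = 0"
proof -
  have "sg a = sg (int (M div 2))" if "(j, a) \<in> quad2 12 (6 * M + 1)" for j a
  proof -
    have "(6 * j - 1)\<^sup>2 + 12 * a\<^sup>2 = int (6 * M + 1)"
      using that by (simp add: quad2_def)
    then have "2 * (j * (3 * j - 1) + a\<^sup>2) = int M"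
      by (simp add: power2_eq_square algebra_simps)
    then have "int (M div 2) = j * (3 * j - 1) + a\<^sup>2"
      by simp
    then show ?thesis
      by (simp add: sg_def)
  qed
  then have "(\<Sum>(j, a)\<in>quad2 12 (6 * M + 1). sg j * sg a) = (\<Sum>(j, a)\<in>quad2 12 (6 * M + 1). sg j * 1) * sg (int (M div 2))"
    unfolding sum_distrib_right by (intro sum.cong) auto
  moreover have "(\<Sum>(j, a)\<in>quad2 12 (6 * M + 1). sg j * sg a) = 0"
    using pent_theta_nth[of 2 sg M] pent_square_nth_0
      gauss_theta[of 2] jtheta_eq_theta_alt[of 2] eta_fps_eq_pent[of 1] eta_fps_eq_pent[of 2]
    by (simp add: theta_alt_def)
  ultimately show ?thesis
    using pent_theta_nth[of 2 "\<lambda>_. 1" M] by (auto simp: theta_def sg_def split: if_splits)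
qed

lemma Mn2: "12 * M + 2 = 14 * n"
  using Mn by simp

text \<open>w is nonzero modulo 7, as otherwise 7 would divide z too and 49 would divide 14n. Since
  24 = -4 modulo 7, each point then has exactly one slope of norm 4.\<close>

lemma sum_quad4_slopes:
  "sum f (quad4 (14 * n)) = (\<Sum>c\<in>norm4_residues. sum f (quad4 (14 * n) \<inter> slope_class c))"
proof -
  have nz: "\<not> (7 dvd a \<and> 7 dvd b)" and ex: "\<exists>c\<in>norm4_residues. slope7 c (6 * j - 1) (6 * l - 1) a b"
    if "((j, l), (a, b)) \<in> quad4 (14 * n)" for j l a b
  proof -
    have e: "(6 * j - 1)\<^sup>2 + (6 * l - 1)\<^sup>2 + 24 * (a\<^sup>2 + b\<^sup>2) = 14 * int n"
      using that by (simp add: quad4_def)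
    show nz: "\<not> (7 dvd a \<and> 7 dvd b)"
    proof
      assume "7 dvd a \<and> 7 dvd b"
      then obtain a' b' where ab: "a = 7 * a'" "b = 7 * b'"
        by (auto elim!: dvdE)
      have "(6 * j - 1)\<^sup>2 + (6 * l - 1)\<^sup>2 = 7 * (2 * int n - 24 * 7 * (a'\<^sup>2 + b'\<^sup>2))"
        using e by (simp add: ab power2_eq_square algebra_simps)
      then have "7 dvd (6 * j - 1)\<^sup>2 + (6 * l - 1)\<^sup>2"
        by simp
      then have "7 dvd 6 * j - 1" "7 dvd 6 * l - 1"
        using seven_dvd_sum_squares by blast+
      then obtain u v where "6 * j - 1 = 7 * u" "6 * l - 1 = 7 * v"
        by (auto elim!: dvdE)
      then have "2 * int n = 7 * (u\<^sup>2 + v\<^sup>2 + 24 * (a'\<^sup>2 + b'\<^sup>2))"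
        using e by (simp add: ab power2_eq_square algebra_simps)
      then have "int n = 7 * (4 * (u\<^sup>2 + v\<^sup>2 + 24 * (a'\<^sup>2 + b'\<^sup>2)) - int n)"
        by simp
      then have "7 dvd int n"
        by (rule dvdI)
      then have "int 7 dvd int n"
        by simp
      then show False
        using n by (simp only: int_dvd_int_iff)
    qed
    have "(6 * j - 1)\<^sup>2 + (6 * l - 1)\<^sup>2 - 4 * (a\<^sup>2 + b\<^sup>2) = 7 * (2 * int n - 4 * (a\<^sup>2 + b\<^sup>2))"
      using e by simp
    then have "7 dvd (6 * j - 1)\<^sup>2 + (6 * l - 1)\<^sup>2 - 4 * (a\<^sup>2 + b\<^sup>2)"
      by (rule dvdI)
    then show "\<exists>c\<in>norm4_residues. slope7 c (6 * j - 1) (6 * l - 1) a b"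
      using nz by (rule slope7_ex)
  qed
  have "quad4 (14 * n) = (\<Union>c\<in>norm4_residues. quad4 (14 * n) \<inter> slope_class c)"
    using ex by (fastforce simp: slope_class_def)
  then have "sum f (quad4 (14 * n)) = sum f (\<Union>c\<in>norm4_residues. quad4 (14 * n) \<inter> slope_class c)"
    by simp
  also have "\<dots> = (\<Sum>c\<in>norm4_residues. sum f (quad4 (14 * n) \<inter> slope_class c))"
  proof (rule sum.UNION_disjoint)
    show "finite norm4_residues"
      by (simp add: norm4_residues_def)
    show "\<forall>c\<in>norm4_residues. finite (quad4 (14 * n) \<inter> slope_class c)"
      using finite_quad4[of M] unfolding Mn2 by blast
    show "\<forall>c\<in>norm4_residues. \<forall>c'\<in>norm4_residues. c \<noteq> c' \<longrightarrow>
      quad4 (14 * n) \<inter> slope_class c \<inter> (quad4 (14 * n) \<inter> slope_class c') = {}"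
      using slope7_unique nz by (fastforce simp: slope_class_def)
  qed
  finally show ?thesis .
qed

text \<open>The four rotations of the slope 2 contribute equally, those of 3 + 3i contribute
  0.\<close>

lemma sum_quad4:
  fixes h :: "int \<Rightarrow> int"
  assumes h: "\<And>a b. h (b - a) = h (a + b)"
  shows "(\<Sum>((j, l), (a, b))\<in>quad4 (14 * n). sg j * sg l * h (a + b)) =
     4 * (\<Sum>((j, l), (a, b))\<in>quad4 (14 * n) \<inter> slope_class (2, 0). sg j * sg l * h (a + b))"
proof -
  let ?f = "\<lambda>c. \<Sum>((j, l), (a, b))\<in>quad4 (14 * n) \<inter> slope_class c. sg j * sg l * h (a + b)"
  note rot = sum_slope_class_rotate[of h, OF h]
  have "?f (0, 2) = ?f (2, 0)" "?f (-2, 0) = ?f (0, 2)" "?f (0, -2) = ?f (-2, 0)"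
    "?f (-3, 3) = ?f (3, 3)" "?f (-3, -3) = ?f (-3, 3)" "?f (3, -3) = ?f (-3, -3)"
    using rot[of "14 * n" 0 2] rot[of "14 * n" 2 0] rot[of "14 * n" 0 "-2"]
      rot[of "14 * n" 3 3] rot[of "14 * n" 3 "-3"] rot[of "14 * n" "-3" "-3"]
    by simp_all
  moreover have "?f (3, 3) = 0"
    by (rule sum_slope_3_3)
  ultimately show ?thesis
    unfolding sum_quad4_slopes norm4_residues_def by simp
qed

lemma pent_theta_alt_nth_0: "fps_nth ((pent 1)\<^sup>2 * (theta_alt 2)\<^sup>2) M = 0"
proof -
  have "sg (b - a) = sg (a + b)" for a b
    by (auto simp: sg_def)
  from sum_quad4[of sg, OF this]
  have "(\<Sum>((j, l), (a, b))\<in>quad4 (14 * n). sg j * sg l * sg (a + b)) = 0"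
    by (simp only: sum_slope_2_0_alt)
  then show ?thesis
    unfolding theta_alt_def pent_square_theta_square_nth Mn2 by (simp only: sg_add)
qed

text \<open>Modulo 7 the form is (x - 2a)(x + 2a), so the points lie on two lines exchanged by a ->
  -a. \<open>descent\<close> parametrises one of them, which gives -2 [Psi]_n: the sign is from
  \<open>descent_norm\<close>, the 2 from \<open>wgf_desc_exp\<close>.\<close>

lemma pent_theta4_nth: "fps_nth (pent 2 * theta 4) M = - 4 * fps_nth Psi n"
proof -
  define R where "R = (\<lambda>d. {(j, a). (j, a) \<in> quad2 24 (7 * n) \<and> 7 dvd 6 * j - 1 - d * a})"
  have fin: "finite (quad2 24 (7 * n))"
  proof -
    have "finite {p. (case p of (j, a) \<Rightarrow> 2 * nat (j * (3 * j - 1)) + 4 * nat \<bar>a\<bar> ^ 2) = M}"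
      by (intro fin_fibresD fin_fibres_pair fin_fibres_pent fin_fibres_square) simp_all
    moreover have "2 * nat (j * (3 * j - 1)) + 4 * nat \<bar>a\<bar> ^ 2 = M" if "(j, a) \<in> quad2 24 (7 * n)" for j a
    proof -
      have "(6 * j - 1)\<^sup>2 + 24 * a\<^sup>2 = int (6 * M + 1)"
        unfolding Mn using that by (simp add: quad2_def)
      then show ?thesis
        unfolding six_minus_one_square abs_square[of a] by linarith
    qed
    then have "quad2 24 (7 * n) \<subseteq> {p. (case p of (j, a) \<Rightarrow> 2 * nat (j * (3 * j - 1)) + 4 * nat \<bar>a\<bar> ^ 2) = M}"
      by auto
    ultimately show ?thesis
      by (rule finite_subset[rotated])
  qed
  have nz: "\<not> (7 dvd 6 * j - 1 \<and> 7 dvd a)" and e: "(6 * j - 1)\<^sup>2 + 24 * a\<^sup>2 = 7 * int n"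
    if "(j, a) \<in> quad2 24 (7 * n)" for j a
    using not_49_dvd[of "6 * j - 1" 24 a] that by (simp_all add: quad2_def)
  have "quad2 24 (7 * n) = R 2 \<union> R (- 2)"
  proof -
    have "7 dvd 6 * j - 1 - 2 * a \<or> 7 dvd 6 * j - 1 - - 2 * a" if "(j, a) \<in> quad2 24 (7 * n)" for j a
    proof -
      have "(6 * j - 1 - 2 * a) * (6 * j - 1 - - 2 * a) = 7 * (int n - 4 * a\<^sup>2)"
        using e[OF that] by (simp add: power2_eq_square algebra_simps)
      then have "7 dvd (6 * j - 1 - 2 * a) * (6 * j - 1 - - 2 * a)"
        by (rule dvdI)
      then show ?thesis
        by (subst (asm) prime_dvd_mult_iff) simp_all
    qed
    then show ?thesis
      by (auto simp: R_def)
  qed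
  moreover have "R 2 \<inter> R (- 2) = {}"
  proof -
    have False if ja: "(j, a) \<in> quad2 24 (7 * n)" "7 dvd 6 * j - 1 - 2 * a" "7 dvd 6 * j - 1 - - 2 * a" for j a
    proof -
      obtain u v where uv: "6 * j - 1 - 2 * a = 7 * u" "6 * j - 1 - - 2 * a = 7 * v"
        using ja(2,3) by (elim dvdE)
      \<comment> \<open>4a = 7v - 7u, and 2 inverts 4 modulo 7.\<close>
      then have "a = 7 * (2 * v - 2 * u - a)"
        by simp
      then have "7 dvd a"
        by (rule dvdI)
      moreover have "7 dvd 7 * u + 2 * a"
        using \<open>7 dvd a\<close> by simp
      then have "7 dvd 6 * j - 1"
        using uv(1) by (simp add: algebra_simps)
      ultimately show False
        using nz[OF ja(1)] by blast
    qed
    then show ?thesis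
      by (auto simp: R_def)
  qed
  moreover have "finite (R 2)" "finite (R (- 2))"
    by (rule finite_subset[OF _ fin]; auto simp: R_def)+
  ultimately have "(\<Sum>(j, a)\<in>quad2 24 (7 * n). sg j) = (\<Sum>(j, a)\<in>R 2. sg j) + (\<Sum>(j, a)\<in>R (- 2). sg j)"
    by (simp only: sum.union_disjoint)
  also have "(\<Sum>(j, a)\<in>R (- 2). sg j) = (\<Sum>(j, a)\<in>R 2. sg j)"
    by (rule sum.reindex_bij_witness[of _ "\<lambda>(j, a). (j, - a)" "\<lambda>(j, a). (j, - a)"])
       (auto simp: R_def quad2_def)
  also have "(\<Sum>(j, a)\<in>R 2. sg j) = - 2 * fps_nth Psi n"
  proof -
    have "R 2 = descent ` {p. desc_exp p = n}"
    proof (intro equalityI subsetI)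
      fix q assume q: "q \<in> R 2"
      obtain j a where ja: "q = (j, a)"
        by (cases q)
      obtain p where p: "descent p = (j, a)"
        using q descent_iff[of j a] by (auto simp: R_def ja)
      have "desc_exp p = n"
        using descent_norm(1)[OF p] e[of j a] q by (simp add: R_def ja)
      then show "q \<in> descent ` {p. desc_exp p = n}"
        using p by (intro image_eqI[of _ _ p]) (simp_all add: ja)
    next
      fix q assume "q \<in> descent ` {p. desc_exp p = n}"
      then obtain p where p: "q = descent p" "desc_exp p = n"
        by blast
      obtain j a where ja: "q = (j, a)"
        by (cases q)
      have "(j, a) \<in> range descent"
        using p by (auto simp: ja[symmetric])
      then show "q \<in> R 2"
        using descent_norm(1)[of p j a] p(2) descent_iff[of j a] unfolding ja
        by (simp add: R_def p(1)[symmetric, unfolded ja] quad2_def)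
    qed
    then have "(\<Sum>(j, a)\<in>R 2. sg j) = (\<Sum>p | desc_exp p = n. case descent p of (j, a) \<Rightarrow> sg j)"
      by (simp add: sum.reindex inj_on_subset[OF inj_descent])
    also have "\<dots> = (\<Sum>p | desc_exp p = n. - sg (fst p))"
      by (intro sum.cong) (auto simp: descent_norm(2) split: prod.splits)
    also have "\<dots> = - fps_nth (wgf (\<lambda>p. sg (fst p)) desc_exp) n"
      by (simp add: wgf_nth sum_negf)
    finally show ?thesis
      by (simp add: wgf_desc_exp numeral_fps_const)
  qed
  finally show ?thesis
    using pent_theta_nth[of 4 "\<lambda>_. 1" M] unfolding Mn by (simp add: theta_def)
qed

text \<open>The slope 2 is real, so z = 2w separates into x = 2a and y = 2b, and each pair descends
  on its own. The two signs cancel, and each of the four equal slopes gives the coefficient of (2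
  Psi)^2 at 2n.\<close>

lemma pent_theta_square_nth:
  "fps_nth ((pent 1)\<^sup>2 * (theta 2)\<^sup>2) M = 16 * fps_nth (Psi\<^sup>2) (2 * n)"
proof -
  let ?S = "quad4 (14 * n) \<inter> slope_class (2, 0)"
  let ?e = "\<lambda>(p, q). desc_exp p + desc_exp q"
  \<comment> \<open>\<open>descent\<close> yields (j, a) and (l, b), while \<open>quad4\<close>
    groups j with l and a with b.\<close>
  let ?F = "\<lambda>(p, q). ((fst (descent p), fst (descent q)), (snd (descent p), snd (descent q)))"
  have S: "?S = ?F ` {r. ?e r = 2 * n}"
  proof (intro equalityI subsetI)
    fix r assume r: "r \<in> ?S"
    obtain j l a b where jl: "r = ((j, l), (a, b))"
      by (cases r) auto
    have e: "(6 * j - 1)\<^sup>2 + (6 * l - 1)\<^sup>2 + 24 * (a\<^sup>2 + b\<^sup>2) = 14 * int n"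
      and d: "7 dvd 6 * j - 1 - 2 * a" "7 dvd 6 * l - 1 - 2 * b"
      using r by (auto simp: jl quad4_def slope_class_def slope7_def)
    obtain p q where pq: "descent p = (j, a)" "descent q = (l, b)"
      using d unfolding descent_iff by (metis rangeE)
    have "7 * int (desc_exp p) + 7 * int (desc_exp q) = 14 * int n"
      unfolding e[symmetric] descent_norm(1)[OF pq(1), symmetric] descent_norm(1)[OF pq(2), symmetric]
      by simp
    then have "?e (p, q) = 2 * n"
      by simp
    moreover have "r = ?F (p, q)"
      by (simp add: jl pq)
    ultimately show "r \<in> ?F ` {r. ?e r = 2 * n}"
      by blast
  next
    fix r assume "r \<in> ?F ` {r. ?e r = 2 * n}"
    then obtain p q where r: "r = ?F (p, q)" and e: "desc_exp p + desc_exp q = 2 * n"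
      by auto
    obtain j a l b where pq: "descent p = (j, a)" "descent q = (l, b)"
      by (cases "descent p", cases "descent q")
    have "7 dvd 6 * j - 1 - 2 * a" "7 dvd 6 * l - 1 - 2 * b"
      using pq unfolding descent_iff by (metis rangeI)+
    moreover have "(6 * j - 1)\<^sup>2 + (6 * l - 1)\<^sup>2 + 24 * (a\<^sup>2 + b\<^sup>2) = 7 * int (desc_exp p + desc_exp q)"
      using descent_norm(1)[OF pq(1)] descent_norm(1)[OF pq(2)] by (simp add: algebra_simps)
    ultimately show "r \<in> ?S"
      unfolding e by (simp add: r pq quad4_def slope_class_def slope7_def)
  qed
  have inj: "inj ?F"
  proof (rule injI)
    fix r r' assume F: "?F r = ?F r'"
    obtain p q p' q' where r: "r = (p, q)" "r' = (p', q')"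
      by (cases r, cases r')
    have "descent p = descent p'" "descent q = descent q'"
      using F unfolding r by (simp_all add: prod_eq_iff)
    then show "r = r'"
      unfolding r inj_eq[OF inj_descent] by simp
  qed
  have "(\<Sum>((j, l), (a, b))\<in>?S. sg j * sg l * 1) =
      (\<Sum>r | ?e r = 2 * n. ((\<lambda>((j, l), (a, b)). sg j * sg l * 1) \<circ> ?F) r)"
    unfolding S by (rule sum.reindex[OF inj_on_subset[OF inj]]) simp
  also have "\<dots> = (\<Sum>r | ?e r = 2 * n. case r of (p, q) \<Rightarrow> sg (fst p) * sg (fst q))"
  proof (rule sum.cong[OF refl])
    fix r :: "(int \<times> int) \<times> (int \<times> int)"
    obtain p q where r: "r = (p, q)"
      by (cases r)
    obtain j a l b where pq: "descent p = (j, a)" "descent q = (l, b)"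
      by (cases "descent p", cases "descent q")
    show "((\<lambda>((j, l), (a, b)). sg j * sg l * 1) \<circ> ?F) r = (case r of (p, q) \<Rightarrow> sg (fst p) * sg (fst q))"
      using descent_norm(2)[OF pq(1)] descent_norm(2)[OF pq(2)] by (simp add: r pq)
  qed
  also have "\<dots> = fps_nth (wgf (\<lambda>p. sg (fst p)) desc_exp * wgf (\<lambda>p. sg (fst p)) desc_exp) (2 * n)"
    by (subst wgf_mult[OF fin_fibres_desc_exp fin_fibres_desc_exp]) (simp add: wgf_nth)
  also have "\<dots> = 4 * fps_nth (Psi\<^sup>2) (2 * n)"
  proof -
    have "(2 * Psi) * (2 * Psi) = fps_const 4 * Psi\<^sup>2"
      by (simp add: power2_eq_square flip: numeral_fps_const)
    then show ?thesis
      unfolding wgf_desc_exp by simp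
  qed
  finally have "4 * (\<Sum>((j, l), (a, b))\<in>?S. sg j * sg l * 1) = 16 * fps_nth (Psi\<^sup>2) (2 * n)"
    by simp
  then have "(\<Sum>((j, l), (a, b))\<in>quad4 (14 * n). sg j * sg l * 1) = 16 * fps_nth (Psi\<^sup>2) (2 * n)"
    using sum_quad4[of "\<lambda>_. 1"] by simp
  then show ?thesis
    unfolding theta_def pent_square_theta_square_nth Mn2 by simp
qed

lemma EO_u_dvd: "64 dvd EO_u M"
proof -
  obtain z where "fps_nth (Psi\<^sup>2) (2 * n) - fps_nth Psi n = 2 * z"
    using Psi_square_parity[of n] by (elim dvdE)
  then have z: "fps_nth (Psi\<^sup>2) (2 * n) = fps_nth Psi n + 2 * z"
    by simp
  have "64 dvd EO_u M - (24 * (- 4 * fps_nth Psi n) - 2 * (16 * fps_nth (Psi\<^sup>2) (2 * n)))"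
    using EO_u_mod_64[of M]
    unfolding pent_nth_0 pent_square_nth_0 pent_theta2_nth_0
      pent_theta_alt_nth_0 pent_theta4_nth pent_theta_square_nth by simp
  \<comment> \<open>With [Psi^2]_2n = [Psi]_n + 2z the remaining combination is -128 [Psi]_n -
    64z.\<close>
  then have "64 dvd (EO_u M - (24 * (- 4 * fps_nth Psi n) - 2 * (16 * fps_nth (Psi\<^sup>2) (2 * n))))
      + 64 * (- 2 * fps_nth Psi n - z)"
    by (rule dvd_add) simp
  also have "\<dots> = EO_u M"
    unfolding z by (simp add: algebra_simps)
  finally show ?thesis .
qed

end

theorem theorem5p2:
  fixes n r :: nat
  assumes "r \<in> {22, 36, 50, 64, 78, 92}"
  shows "[EO_u (98 * n + r) = 0] (mod 64)"
proof -
  \<comment> \<open>The even r below 98 with 7 dividing 6r + 1 are these six and 8; for r = 8 the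
    quotient (6r + 1) / 7 is 7 itself.\<close>
  have "6 * (98 * n + r) + 1 = 7 * (84 * n + (6 * r + 1) div 7) \<and> \<not> 7 dvd 84 * n + (6 * r + 1) div 7"
    using assms by (auto; presburger)
  then have "64 dvd EO_u (98 * n + r)"
    using EO_u_dvd by blast
  then show ?thesis
    by (simp add: cong_0_iff)
qed

end
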